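(* Let $\mathcal{C}$ be an arbitrary set of corner-interval minors of $M$, and let $V\subset V(\mathcal{C})$ be an admissible set of $\mathcal{C}$. For an admissible set $W$ put $\mathcal{C}'=\{\delta\in\mathcal{C}\mid V(\delta)\cap W=\emptyset\}$, and put $\mathcal{C}''=\{\delta\in\mathcal{C}\mid V(\delta)\cap V=\emptyset\}$, so that $P_W(\mathcal{C})=(W)+J_{\mathcal{C}'}$ and $P_V(\mathcal{C})=(V)+J_{\mathcal{C}''}$. Then $P_V(\mathcal{C})$ is a minimal prime of $I(\mathcal{C})$ if and only if for every admissible set $W\subsetneq V$ of $\mathcal{C}$ there exist $r\ge 2$ and a cycle $\sigma: h_{i_1},v_{j_1},h_{i_2},v_{j_2},\ldots,h_{i_r},v_{j_r}$ in $G(\mathcal{C}')$ with $f_\sigma\in J_{\mathcal{C}'}\setminus J_{\mathcal{C}''}$ such that for all $1\le k,l\le r$ at least one of the two vertices $x_{a_{i_k},b_{j_k}}$ and $x_{a_{i_{l+1}},b_{j_l}}$ does not belong to $V$ (where $i_{r+1}=i_1$).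
   Context: Let $K$ be a field and $M=(x_{ij})$ an $m\times n$ matrix of indeterminates. A 2-minor is $\delta=[a_1,a_2|b_1,b_2]$ with $a_1<a_2$, $b_1<b_2$; $f_\delta=x_{a_1b_1}x_{a_2b_2}-x_{a_1b_2}x_{a_2b_1}$. Its vertex set is $V(\delta)=\{x_{a_1b_1},x_{a_1b_2},x_{a_2b_1},x_{a_2b_2}\}$; its edges are the horizontal edges $\{x_{a_1b_1},x_{a_1b_2}\}$, $\{x_{a_2b_1},x_{a_2b_2}\}$ and the vertical edges $\{x_{a_1b_1},x_{a_2b_1}\}$, $\{x_{a_1b_2},x_{a_2b_2}\}$. It is a corner-interval minor if $b_1=1$. For a set $\mathcal{C}$ of 2-minors, $V(\mathcal{C})$ and $E(\mathcal{C})$ are the unions of the vertex sets and edge sets of its members, $S=K[x_{ij}\mid x_{ij}\in V(\mathcal{C})]$, and $I(\mathcal{C})=(f_\delta\mid\delta\in\mathcal{C})\subset S$. A vertical interval of $\mathcal{C}$ is a set of vertices of $V(\mathcal{C})$ lying in one column of $M$ such that any two of them are joined by a path of vertical edges of $\mathcal{C}$; it is maximal if it is not strictly contained in another vertical interval. (Maximal) horizontal intervals are defined analogously with rows and horizontal edges. Let $V_1,\dots,V_p$ and $H_1,\dots,H_q$ be the maximal vertical and maximal horizontal intervals of $\mathcal{C}$. $G(\mathcal{C})$ is the bipartite graph with vertices $v_1,\dots,v_p,h_1,\dots,h_q$ and edges $\{h_i,v_j\}$ for $H_i\cap V_j\ne\emptyset$; in that case $H_i\cap V_j$ is a single vertex,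 denoted $x_{a_i b_j}$. For a cycle $\sigma:h_{i_1},v_{j_1},\dots,h_{i_r},v_{j_r}$ ($r\ge2$) in $G(\mathcal{C})$ put $f_\sigma=\prod_{k=1}^r x_{a_{i_k},b_{j_k}}-\prod_{k=1}^r x_{a_{i_{k+1}},b_{j_k}}$ with $i_{r+1}=i_1$. $J_{\mathcal{C}}$ is the ideal generated by all $f_\sigma$, $\sigma$ a cycle in $G(\mathcal{C})$. For a subset $\mathcal{D}\subset\mathcal{C}$, $G(\mathcal{D})$ and $J_{\mathcal{D}}$ are formed from the intervals of $\mathcal{D}$, and $J_{\mathcal{D}}$ is regarded as an ideal of $S$ by extension (zero if $\mathcal{D}=\emptyset$). A subset $W\subset V(\mathcal{C})$ is admissible if for each $\delta\in\mathcal{C}$ either $W\cap V(\delta)=\emptyset$ or $W\cap V(\delta)$ contains an edge of $\delta$. For admissible $W$, $P_W(\mathcal{C})=(x_{ij}\mid x_{ij}\in W)+J_{\mathcal{C}'}\subset S$ with $\mathcal{C}'=\{\delta\in\mathcal{C}\mid V(\delta)\cap W=\emptyset\}$; it is a prime ideal. *)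

theory Defs
  imports "HOL-Library.Poly_Mapping" "HOL-Algebra.Ideal"
begin

section \<open>Polynomial rings in the entries of a matrix\<close>

text \<open>
  The indeterminate in row \<open>i\<close> and column \<open>j\<close> of the matrix is identified with its
  position \<open>(i, j)\<close>; rows and columns are counted from 1.
\<close>

type_synonym vertex = "nat \<times> nat"
type_synonym 'k vpoly = "(vertex \<Rightarrow>\<^sub>0 nat) \<Rightarrow>\<^sub>0 'k"

definition indet :: "vertex \<Rightarrow> 'k::field vpoly" where
  "indet x = Poly_Mapping.single (Poly_Mapping.single x 1) 1"

definition poly_ring :: "vertex set \<Rightarrow> 'k::field vpoly ring" where
  "poly_ring U =
     \<lparr>carrier = {p. \<forall>t \<in> Poly_Mapping.keys p. Poly_Mapping.keys t \<subseteq> U},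
      monoid.mult = (*), one = 1, zero = 0, add = (+)\<rparr>"

definition minimal_prime :: "('a, 'b) ring_scheme \<Rightarrow> 'a set \<Rightarrow> 'a set \<Rightarrow> bool" where
  "minimal_prime R I P \<longleftrightarrow>
     primeideal P R \<and> I \<subseteq> P \<and> (\<forall>Q. primeideal Q R \<and> I \<subseteq> Q \<and> Q \<subseteq> P \<longrightarrow> Q = P)"


section \<open>Sets of 2-minors\<close>

text \<open>The minor with rows \<open>a1 < a2\<close> and columns \<open>b1 < b2\<close> is \<open>Minor a1 a2 b1 b2\<close>.\<close>

datatype minor = Minor nat nat nat nat

fun minor_poly :: "minor \<Rightarrow> 'k::field vpoly" where
  "minor_poly (Minor a1 a2 b1 b2) =
     indet (a1, b1) * indet (a2, b2) - indet (a1, b2) * indet (a2, b1)"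

fun minor_verts :: "minor \<Rightarrow> vertex set" where
  "minor_verts (Minor a1 a2 b1 b2) = {(a1, b1), (a1, b2), (a2, b1), (a2, b2)}"

fun minor_hedges :: "minor \<Rightarrow> vertex set set" where
  "minor_hedges (Minor a1 a2 b1 b2) = {{(a1, b1), (a1, b2)}, {(a2, b1), (a2, b2)}}"

fun minor_vedges :: "minor \<Rightarrow> vertex set set" where
  "minor_vedges (Minor a1 a2 b1 b2) = {{(a1, b1), (a2, b1)}, {(a1, b2), (a2, b2)}}"

definition minor_edges :: "minor \<Rightarrow> vertex set set" where
  "minor_edges d = minor_hedges d \<union> minor_vedges d"

definition two_minors :: "nat \<Rightarrow> nat \<Rightarrow> minor set" where
  "two_minors m n =
     {Minor a1 a2 b1 b2 | a1 a2 b1 b2. 1 \<le> a1 \<and> a1 < a2 \<and> a2 \<le> m \<and> 1 \<le> b1 \<and> b1 < b2 \<and> b2 \<le> n}"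

fun corner_interval :: "minor \<Rightarrow> bool" where
  "corner_interval (Minor a1 a2 b1 b2) \<longleftrightarrow> b1 = 1"

definition verts_of :: "minor set \<Rightarrow> vertex set" where
  "verts_of C = (\<Union>d\<in>C. minor_verts d)"

definition hedges_of :: "minor set \<Rightarrow> vertex set set" where
  "hedges_of C = (\<Union>d\<in>C. minor_hedges d)"

definition vedges_of :: "minor set \<Rightarrow> vertex set set" where
  "vedges_of C = (\<Union>d\<in>C. minor_vedges d)"

definition ambient_ring :: "minor set \<Rightarrow> 'k::field vpoly ring" where
  "ambient_ring C = poly_ring (verts_of C)"

definition minor_ideal :: "minor set \<Rightarrow> 'k::field vpoly set" where
  "minor_ideal C = genideal (ambient_ring C) (minor_poly ` C)"


section \<open>Intervals and the bipartite graph\<close>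

definition joined_by_path :: "vertex set set \<Rightarrow> vertex \<Rightarrow> vertex \<Rightarrow> bool" where
  "joined_by_path E x y \<longleftrightarrow> (x, y) \<in> {(u, w). {u, w} \<in> E}\<^sup>*"

definition vertical_interval :: "minor set \<Rightarrow> vertex set \<Rightarrow> bool" where
  "vertical_interval C U \<longleftrightarrow>
     U \<subseteq> verts_of C \<and> (\<exists>b. \<forall>x\<in>U. snd x = b) \<and>
     (\<forall>x\<in>U. \<forall>y\<in>U. joined_by_path (vedges_of C) x y)"

definition horizontal_interval :: "minor set \<Rightarrow> vertex set \<Rightarrow> bool" where
  "horizontal_interval C U \<longleftrightarrow>
     U \<subseteq> verts_of C \<and> (\<exists>a. \<forall>x\<in>U. fst x = a) \<and>
     (\<forall>x\<in>U. \<forall>y\<in>U. joined_by_path (hedges_of C) x y)"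

definition max_vertical_intervals :: "minor set \<Rightarrow> vertex set set" where
  "max_vertical_intervals C =
     {U. vertical_interval C U \<and> (\<nexists>U'. vertical_interval C U' \<and> U \<subset> U')}"

definition max_horizontal_intervals :: "minor set \<Rightarrow> vertex set set" where
  "max_horizontal_intervals C =
     {U. horizontal_interval C U \<and> (\<nexists>U'. horizontal_interval C U' \<and> U \<subset> U')}"

text \<open>
  The vertices \<open>h\<^sub>i\<close> and \<open>v\<^sub>j\<close> of the bipartite graph are represented by \<open>Inl H\<^sub>i\<close> and
  \<open>Inr V\<^sub>j\<close>.
\<close>

definition graph_edges :: "minor set \<Rightarrow> (vertex set + vertex set) set set" where
  "graph_edges C =
     {{Inl H, Inr V} | H V. H \<in> max_horizontal_intervals C \<and> V \<in> max_vertical_intervals C \<and>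
        H \<inter> V \<noteq> {}}"

text \<open>
  A cycle \<open>h\<^sub>i\<^sub>1, v\<^sub>j\<^sub>1, \<dots>, h\<^sub>i\<^sub>r, v\<^sub>j\<^sub>r\<close> is given by the list \<open>hs\<close> of its
  horizontal and the list \<open>vs\<close> of its vertical intervals, both of length \<open>r\<close> and
  indexed from 0, so that the successor of the index \<open>k\<close> is \<open>Suc k mod r\<close>. As usual for
  cycles in graphs, the vertices are pairwise distinct.
\<close>

definition graph_cycle :: "minor set \<Rightarrow> vertex set list \<Rightarrow> vertex set list \<Rightarrow> bool" where
  "graph_cycle C hs vs \<longleftrightarrow>
     length hs = length vs \<and> 2 \<le> length hs \<and>
     set hs \<subseteq> max_horizontal_intervals C \<and> set vs \<subseteq> max_vertical_intervals C \<and>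
     distinct hs \<and> distinct vs \<and>
     (\<forall>k < length hs.
        {Inl (hs ! k), Inr (vs ! k)} \<in> graph_edges C \<and>
        {Inr (vs ! k), Inl (hs ! (Suc k mod length hs))} \<in> graph_edges C)"

definition crossing :: "vertex set \<Rightarrow> vertex set \<Rightarrow> vertex" where
  "crossing H V = the_elem (H \<inter> V)"

text \<open>
  Along the cycle, \<open>cycle_out\<close> is the vertex of the edge from \<open>h\<^sub>i\<^sub>k\<close> to \<open>v\<^sub>j\<^sub>k\<close> and
  \<open>cycle_in\<close> that of the edge from \<open>v\<^sub>j\<^sub>k\<close> to the next horizontal interval.
\<close>

definition cycle_out :: "vertex set list \<Rightarrow> vertex set list \<Rightarrow> nat \<Rightarrow> vertex" where
  "cycle_out hs vs k = crossing (hs ! k) (vs ! k)"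

definition cycle_in :: "vertex set list \<Rightarrow> vertex set list \<Rightarrow> nat \<Rightarrow> vertex" where
  "cycle_in hs vs k = crossing (hs ! (Suc k mod length hs)) (vs ! k)"

definition cycle_poly :: "vertex set list \<Rightarrow> vertex set list \<Rightarrow> 'k::field vpoly" where
  "cycle_poly hs vs =
     (\<Prod>k<length hs. indet (cycle_out hs vs k)) - (\<Prod>k<length hs. indet (cycle_in hs vs k))"

text \<open>
  For \<open>D \<subseteq> C\<close>, the ideal generated by the cycle binomials of \<open>D\<close>, extended to the polynomial
  ring of \<open>C\<close>. The extension is generated by the same elements.
\<close>

definition cycle_ideal :: "minor set \<Rightarrow> minor set \<Rightarrow> 'k::field vpoly set" where
  "cycle_ideal C D =
     genideal (ambient_ring C) {cycle_poly hs vs | hs vs. graph_cycle D hs vs}"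


section \<open>Admissible sets\<close>

definition admissible :: "minor set \<Rightarrow> vertex set \<Rightarrow> bool" where
  "admissible C W \<longleftrightarrow>
     W \<subseteq> verts_of C \<and>
     (\<forall>d\<in>C. W \<inter> minor_verts d = {} \<or> (\<exists>e\<in>minor_edges d. e \<subseteq> W \<inter> minor_verts d))"

definition avoiding :: "minor set \<Rightarrow> vertex set \<Rightarrow> minor set" where
  "avoiding C W = {d\<in>C. minor_verts d \<inter> W = {}}"

definition admissible_ideal :: "minor set \<Rightarrow> vertex set \<Rightarrow> 'k::field vpoly set" where
  "admissible_ideal C W =
     genideal (ambient_ring C) (indet ` W) <+>\<^bsub>ambient_ring C\<^esub> cycle_ideal C (avoiding C W)"


section \<open>Well-definedness\<close>

lemma poly_ring_simps [simp]:
  "monoid.mult (poly_ring U) = (*)" "one (poly_ring U) = 1"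
  "zero (poly_ring U) = 0" "add (poly_ring U) = (+)"
  by (simp_all add: poly_ring_def)

lemma carrier_poly_ring:
  "p \<in> carrier (poly_ring U) \<longleftrightarrow> (\<forall>t \<in> Poly_Mapping.keys p. Poly_Mapping.keys t \<subseteq> U)"
  by (simp add: poly_ring_def)

lemma poly_ring_closed:
  fixes p q :: "'k::field vpoly"
  assumes "p \<in> carrier (poly_ring U)" "q \<in> carrier (poly_ring U)"
  shows "p + q \<in> carrier (poly_ring U)" "p * q \<in> carrier (poly_ring U)"
    "- p \<in> carrier (poly_ring U)" "p - q \<in> carrier (poly_ring U)"
proof -
  show add: "p + q \<in> carrier (poly_ring U)"
    using assms Poly_Mapping.keys_add[of p q] unfolding carrier_poly_ring by blast
  have key_add: "Poly_Mapping.keys (s + t) \<subseteq> U"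
    if "Poly_Mapping.keys s \<subseteq> U" "Poly_Mapping.keys t \<subseteq> U" for s t :: "vertex \<Rightarrow>\<^sub>0 nat"
    using that Poly_Mapping.keys_add[of s t] by blast
  show "p * q \<in> carrier (poly_ring U)"
    using assms keys_mult[of p q] key_add unfolding carrier_poly_ring by blast
  have keys_uminus: "Poly_Mapping.keys (- r) = Poly_Mapping.keys r" for r :: "'k vpoly"
    by (auto simp: in_keys_iff)
  show "- p \<in> carrier (poly_ring U)"
    using assms by (simp add: carrier_poly_ring keys_uminus)
  have "Poly_Mapping.keys (p - q) \<subseteq> Poly_Mapping.keys p \<union> Poly_Mapping.keys q"
    by (auto simp: in_keys_iff lookup_minus)
  then show "p - q \<in> carrier (poly_ring U)"
    using assms unfolding carrier_poly_ring by blast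
qed

lemma indet_closed: "x \<in> U \<Longrightarrow> indet x \<in> carrier (poly_ring U)"
  by (simp add: carrier_poly_ring indet_def)

lemma zero_closed: "0 \<in> carrier (poly_ring U)"
  by (simp add: carrier_poly_ring)

lemma one_closed: "1 \<in> carrier (poly_ring U)"
  by (simp add: carrier_poly_ring)

lemma prod_closed:
  "(\<And>k. k \<in> A \<Longrightarrow> f k \<in> carrier (poly_ring U)) \<Longrightarrow> prod f A \<in> carrier (poly_ring U)"
  by (induction A rule: infinite_finite_induct) (auto intro: one_closed poly_ring_closed(2))

lemma cring_poly_ring: "cring (poly_ring U :: 'k::field vpoly ring)"
proof (rule cringI)
  show "abelian_group (poly_ring U :: 'k vpoly ring)"
  proof (rule abelian_groupI)
    fix x :: "'k vpoly" assume "x \<in> carrier (poly_ring U)"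
    then have "- x \<in> carrier (poly_ring U)" using poly_ring_closed(3)[of x U x] by simp
    then show "\<exists>y \<in> carrier (poly_ring U). y \<oplus>\<^bsub>poly_ring U\<^esub> x = \<zero>\<^bsub>poly_ring U\<^esub>"
      by (intro bexI[of _ "- x"]) auto
  qed (auto simp: poly_ring_closed zero_closed algebra_simps)
  show "comm_monoid (poly_ring U :: 'k vpoly ring)"
    by (rule comm_monoidI) (auto simp: poly_ring_closed one_closed algebra_simps)
qed (simp add: algebra_simps)

lemma verts_of_mono: "D \<subseteq> C \<Longrightarrow> verts_of D \<subseteq> verts_of C"
  by (auto simp: verts_of_def)

lemma minor_poly_closed:
  assumes "d \<in> C"
  shows "minor_poly d \<in> carrier (ambient_ring C)"
proof (cases d)
  case (Minor a1 a2 b1 b2)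
  have "minor_verts d \<subseteq> verts_of C"
    using assms by (auto simp: verts_of_def)
  then show ?thesis
    by (auto simp: Minor ambient_ring_def intro!: poly_ring_closed indet_closed)
qed

lemma crossing:
  assumes "horizontal_interval C H" "vertical_interval C V" "H \<inter> V \<noteq> {}"
  shows "H \<inter> V = {crossing H V}"
proof -
  obtain a b where "\<forall>x\<in>H. fst x = a" "\<forall>x\<in>V. snd x = b"
    using assms unfolding horizontal_interval_def vertical_interval_def by blast
  then have "H \<inter> V \<subseteq> {(a, b)}" by force
  with assms(3) have "H \<inter> V = {(a, b)}" by blast
  then show ?thesis by (simp add: crossing_def)
qed

lemma graph_edgesD:
  assumes "{Inl H, Inr V} \<in> graph_edges C"
  shows "H \<in> max_horizontal_intervals C" "V \<in> max_vertical_intervals C" "H \<inter> V \<noteq> {}"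
  using assms by (auto simp: graph_edges_def doubleton_eq_iff)

lemma crossing_in_verts:
  assumes "{Inl H, Inr V} \<in> graph_edges C"
  shows "crossing H V \<in> verts_of C"
proof -
  have "horizontal_interval C H" "vertical_interval C V" "H \<inter> V \<noteq> {}"
    using graph_edgesD[OF assms]
    by (auto simp: max_horizontal_intervals_def max_vertical_intervals_def)
  with crossing[OF this] show ?thesis
    by (auto simp: horizontal_interval_def)
qed

lemma cycle_poly_closed:
  assumes "graph_cycle D hs vs" "D \<subseteq> C"
  shows "cycle_poly hs vs \<in> carrier (ambient_ring C)"
proof -
  have "cycle_out hs vs k \<in> verts_of C" "cycle_in hs vs k \<in> verts_of C" if "k < length hs" for k
  proof -
    have "{Inl (hs ! k), Inr (vs ! k)} \<in> graph_edges D"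
      "{Inl (hs ! (Suc k mod length hs)), Inr (vs ! k)} \<in> graph_edges D"
      using assms(1) that by (auto simp: graph_cycle_def insert_commute)
    then show "cycle_out hs vs k \<in> verts_of C" "cycle_in hs vs k \<in> verts_of C"
      using verts_of_mono[OF assms(2)] crossing_in_verts
      unfolding cycle_out_def cycle_in_def by blast+
  qed
  then show ?thesis
    unfolding cycle_poly_def ambient_ring_def
    by (intro poly_ring_closed prod_closed indet_closed) auto
qed

end

theory Submission
  imports Defs "HOL-Library.Countable"
begin

text \<open>
  Modulo the vertices in \<open>W\<close>, the ideal \<open>P\<^sub>W(C)\<close> is the kernel of a toric map, sending each remaining
  vertex to a variable for its horizontal times a variable for its vertical interval: a binomial
  in the kernel is reduced by walking alternately through the supports of its two monomials until
  a cycle closes. So \<open>P\<^sub>W(C)\<close> is prime and contains exactly the vertices in \<open>W\<close>.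

  If a prime \<open>Q\<close> contains \<open>I(C)\<close>, then the set \<open>W\<close> of vertices in \<open>Q\<close> is admissible, and
  \<open>P\<^sub>W(C) \<subseteq> Q\<close>. Hence \<open>P\<^sub>V(C)\<close> is minimal iff it contains no \<open>P\<^sub>W(C)\<close> with \<open>W \<subset> V\<close>. Finally a
  cycle binomial lies in \<open>P\<^sub>V(C)\<close> iff both of its monomials meet \<open>V\<close> or it lies in the ideal of
  the minors avoiding \<open>V\<close>.
\<close>

section \<open>Notation for supports, coefficients and monomials\<close>

abbreviation keys :: "('a \<Rightarrow>\<^sub>0 'b::zero) \<Rightarrow> 'a set" where
  "keys \<equiv> Poly_Mapping.keys"

abbreviation lookup :: "('a \<Rightarrow>\<^sub>0 'b::zero) \<Rightarrow> 'a \<Rightarrow> 'b" where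
  "lookup \<equiv> Poly_Mapping.lookup"

abbreviation monomial :: "(vertex \<Rightarrow>\<^sub>0 nat) \<Rightarrow> 'k::field vpoly" where
  "monomial t \<equiv> Poly_Mapping.single t 1"

abbreviation squarefree_monomial :: "(nat \<Rightarrow> vertex) \<Rightarrow> nat \<Rightarrow> vertex \<Rightarrow>\<^sub>0 nat" where
  "squarefree_monomial f r \<equiv> \<Sum>k<r. Poly_Mapping.single (f k) 1"


section \<open>Additive maps on finitely supported functions\<close>

lemma poly_mapping_sum_single:
  "p = (\<Sum>t\<in>keys p. Poly_Mapping.single t (lookup p t))"
  by (rule poly_mapping_eqI) (simp add: lookup_sum lookup_single when_def in_keys_iff)

text \<open>Coefficients are added over the fibres of \<open>f\<close>. On exponent vectors this is
  the substitution of the variable \<open>f x\<close> for \<open>x\<close>; on polynomials it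
  replaces each monomial \<open>t\<close> by \<open>f t\<close>.\<close>

definition push :: "('a \<Rightarrow> 'b) \<Rightarrow> ('a \<Rightarrow>\<^sub>0 'c::comm_monoid_add) \<Rightarrow> 'b \<Rightarrow>\<^sub>0 'c" where
  "push f p = (\<Sum>t\<in>keys p. Poly_Mapping.single (f t) (lookup p t))"

lemma push_zero [simp]: "push f 0 = 0"
  by (simp add: push_def)

lemma push_single [simp]: "push f (Poly_Mapping.single t c) = Poly_Mapping.single (f t) c"
  by (simp add: push_def)

lemma push_add: "push f (p + q) = push f p + push f q"
  unfolding push_def by (rule setsum_keys_plus_distrib) (simp_all add: single_add)

lemma push_sum: "push f (\<Sum>k\<in>A. g k) = (\<Sum>k\<in>A. push f (g k))"
  by (induction A rule: infinite_finite_induct) (simp_all add: push_add)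

text \<open>Natural numbers cannot cancel, so no variable is lost when exponent vectors are
  added.\<close>

lemma keys_add_nat: "keys (s + t) = keys s \<union> keys t" for s t :: "'a \<Rightarrow>\<^sub>0 nat"
  by (auto simp: in_keys_iff lookup_add)

lemma keys_sum_nat:
  "finite A \<Longrightarrow> keys (\<Sum>k\<in>A. f k) = (\<Union>k\<in>A. keys (f k))" for f :: "'b \<Rightarrow> 'a \<Rightarrow>\<^sub>0 nat"
  by (induction A rule: finite_induct) (simp_all add: keys_add_nat)

lemma keys_push_nat: "keys (push f t) = f ` keys t" for t :: "'a \<Rightarrow>\<^sub>0 nat"
  by (auto simp: push_def keys_sum_nat in_keys_iff)

text \<open>The total degree of a monomial, the measure in the induction that reduces binomials by
  cycles.\<close>

definition deg :: "('a \<Rightarrow>\<^sub>0 nat) \<Rightarrow> nat" where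
  "deg t = (\<Sum>x\<in>keys t. lookup t x)"

lemma deg_add: "deg (s + t) = deg s + deg t"
  unfolding deg_def by (rule setsum_keys_plus_distrib) simp_all

lemma deg_single [simp]: "deg (Poly_Mapping.single x n) = n"
  by (simp add: deg_def)

lemma split_key_nat:
  fixes t :: "'a \<Rightarrow>\<^sub>0 nat"
  assumes "x \<in> keys t"
  obtains r where "t = Poly_Mapping.single x 1 + r"
proof
  show "t = Poly_Mapping.single x 1 + (t - Poly_Mapping.single x 1)"
    using assms by (intro poly_mapping_eqI)
      (auto simp: lookup_add lookup_minus lookup_single when_def in_keys_iff)
qed

text \<open>By injectivity every exponent of the squarefree product is at most 1, so the product
  divides any monomial whose support contains its variables; \<open>r\<close> is the
  quotient.\<close>

lemma split_squarefree:
  fixes t :: "'a \<Rightarrow>\<^sub>0 nat"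
  assumes "inj_on f A" "f ` A \<subseteq> keys t" "finite A"
  obtains r where "t = (\<Sum>k\<in>A. Poly_Mapping.single (f k) 1) + r"
proof
  let ?m = "\<Sum>k\<in>A. Poly_Mapping.single (f k) (1::nat)"
  have "lookup ?m x = card {k \<in> A. f k = x}" for x
    using assms(3) by (simp add: lookup_sum lookup_single when_def sum.If_cases Int_def)
  moreover have "card {k \<in> A. f k = x} \<le> lookup t x" for x
  proof (cases "x \<in> f ` A")
    case True
    then obtain k where "k \<in> A" "f k = x" by blast
    then have "{k \<in> A. f k = x} = {k}"
      using assms(1) by (auto dest: inj_onD)
    moreover have "lookup t x > 0"
      using assms(2) True by (auto simp: in_keys_iff)
    ultimately show ?thesis by simp
  next
    case False
    then have "{k \<in> A. f k = x} = {}" by blast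
    then show ?thesis by (simp only: card.empty)
  qed
  ultimately show "t = ?m + (t - ?m)"
    by (intro poly_mapping_eqI) (simp add: lookup_add lookup_minus)
qed

lemma prod_indet: "(\<Prod>k<r. indet (f k)) = monomial (squarefree_monomial f r)"
proof (induction r)
  case (Suc r)
  then show ?case
    by (simp add: indet_def mult_single add.commute)
qed simp

lemma keys_squarefree_monomial: "keys (squarefree_monomial f r) = f ` {..<r}"
  by (auto simp: keys_sum_nat)


section \<open>Ideals of the polynomial ring\<close>

lemma monomial_closed: "keys t \<subseteq> U \<Longrightarrow> Poly_Mapping.single t c \<in> carrier (poly_ring U)"
  by (simp add: carrier_poly_ring)

context
  fixes U :: "vertex set" and I :: "'k::field vpoly set"
  assumes ideal: "ideal I (poly_ring U)"
begin

lemma ideal_subset: "I \<subseteq> carrier (poly_ring U)"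
  using ideal additive_subgroup.a_subset ideal.axioms(1) by blast

lemma ideal_zero: "0 \<in> I"
  using additive_subgroup.zero_closed[OF ideal.axioms(1)[OF ideal]] by simp

lemma ideal_add: "p \<in> I \<Longrightarrow> q \<in> I \<Longrightarrow> p + q \<in> I"
  using additive_subgroup.a_closed[OF ideal.axioms(1)[OF ideal]] by fastforce

lemma ideal_mult: "p \<in> I \<Longrightarrow> a \<in> carrier (poly_ring U) \<Longrightarrow> a * p \<in> I"
  using ideal.I_l_closed[OF ideal] by fastforce

lemma ideal_diff:
  assumes "p \<in> I" "q \<in> I"
  shows "p - q \<in> I"
proof -
  have "(- 1) * q \<in> I"
    using assms(2) poly_ring_closed(3)[OF one_closed one_closed] by (rule ideal_mult)
  with assms(1) show ?thesis
    using ideal_add by fastforce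
qed

lemma ideal_sum: "(\<And>k. k \<in> A \<Longrightarrow> f k \<in> I) \<Longrightarrow> sum f A \<in> I"
  by (induction A rule: infinite_finite_induct) (auto intro: ideal_zero ideal_add)

end

text \<open>Additive inverses come from multiplication by \<open>- 1\<close>; the abstract inverse
  of the ring record is identified with \<open>- p\<close> by uniqueness of inverses.\<close>

lemma ideal_poly_ringI:
  fixes I :: "'k::field vpoly set"
  assumes "I \<subseteq> carrier (poly_ring U)" "0 \<in> I"
    and "\<And>p q. p \<in> I \<Longrightarrow> q \<in> I \<Longrightarrow> p + q \<in> I"
    and mult: "\<And>p a. p \<in> I \<Longrightarrow> a \<in> carrier (poly_ring U) \<Longrightarrow> a * p \<in> I"
  shows "ideal I (poly_ring U)"
proof (rule idealI)
  interpret cring "poly_ring U :: 'k vpoly ring" by (rule cring_poly_ring)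
  show "ring (poly_ring U :: 'k vpoly ring)" by (rule ring_axioms)
  have neg: "- p \<in> I" if "p \<in> I" for p
    using mult[OF that, of "- 1"] poly_ring_closed(3)[OF one_closed one_closed] by simp
  have inv: "inv\<^bsub>add_monoid (poly_ring U)\<^esub> p = - p" if "p \<in> I" for p
    using that assms(1) neg
    by (intro comm_monoid.comm_inv_char[OF a_comm_monoid]) auto
  show "subgroup I (add_monoid (poly_ring U))"
    using assms(1-3) neg inv by (intro subgroup.intro) auto
qed (use mult in \<open>auto simp: mult.commute\<close>)

lemma genideal_poly_ring:
  fixes S :: "'k::field vpoly set"
  assumes "S \<subseteq> carrier (poly_ring U)"
  shows "ideal (genideal (poly_ring U) S) (poly_ring U)"
    and "S \<subseteq> genideal (poly_ring U) S"
  using ring.genideal_ideal[OF cring.axioms(1)[OF cring_poly_ring]]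
    ring.genideal_self[OF cring.axioms(1)[OF cring_poly_ring]] assms by blast+

lemma genideal_poly_ring_le:
  fixes S :: "'k::field vpoly set"
  assumes "ideal I (poly_ring U)" "S \<subseteq> I"
  shows "genideal (poly_ring U) S \<subseteq> I"
  using ring.genideal_minimal[OF cring.axioms(1)[OF cring_poly_ring]] assms by blast


section \<open>Classes of vertices\<close>

lemma sym_joined: "joined_by_path E x y \<Longrightarrow> joined_by_path E y x"
proof -
  have "sym ({(u, w). {u, w} \<in> E}\<^sup>*)"
    by (intro sym_rtrancl) (auto simp: sym_def insert_commute)
  then show "joined_by_path E x y \<Longrightarrow> joined_by_path E y x"
    by (auto simp: joined_by_path_def dest: symD)
qed

lemma trans_joined: "joined_by_path E x y \<Longrightarrow> joined_by_path E y z \<Longrightarrow> joined_by_path E x z"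
  by (simp add: joined_by_path_def)

lemma refl_joined [simp]: "joined_by_path E x x"
  by (simp add: joined_by_path_def)

lemma edge_joined: "{x, y} \<in> E \<Longrightarrow> joined_by_path E x y"
  by (auto simp: joined_by_path_def)

text \<open>A representative vertex, rather than the class as a set, keeps the values in a countable
  type, as the coding by \<open>to_nat\<close> requires.\<close>

definition class_rep :: "vertex set set \<Rightarrow> vertex \<Rightarrow> vertex" where
  "class_rep E x = (SOME y. joined_by_path E x y)"

text \<open>The choice depends only on the set of vertices joined to \<open>x\<close>, and joined
  vertices have the same such set.\<close>

lemma class_rep_eq_iff: "class_rep E x = class_rep E y \<longleftrightarrow> joined_by_path E x y"
proof
  have "joined_by_path E x (class_rep E x)" for x
    unfolding class_rep_def by (rule someI[of _ x]) simp
  then show "class_rep E x = class_rep E y \<Longrightarrow> joined_by_path E x y"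
    by (metis sym_joined trans_joined)
  assume "joined_by_path E x y"
  then have "joined_by_path E x = joined_by_path E y"
    by (intro ext) (blast intro: sym_joined trans_joined)
  then show "class_rep E x = class_rep E y"
    by (simp add: class_rep_def)
qed

lemma joined_hedges_fst:
  assumes "joined_by_path (hedges_of D) x y"
  shows "fst x = fst y"
proof -
  have "fst u = fst w" if "{u, w} \<in> minor_hedges d" for u w d
    using that by (cases d) (auto simp: doubleton_eq_iff)
  then have step: "fst u = fst w" if "{u, w} \<in> hedges_of D" for u w
    using that unfolding hedges_of_def by blast
  show ?thesis
    using assms unfolding joined_by_path_def
    by (induction rule: rtrancl_induct) (simp_all add: step)
qed

lemma joined_vedges_snd:
  assumes "joined_by_path (vedges_of D) x y"
  shows "snd x = snd y"
proof -
  have "snd u = snd w" if "{u, w} \<in> minor_vedges d" for u w d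
    using that by (cases d) (auto simp: doubleton_eq_iff)
  then have step: "snd u = snd w" if "{u, w} \<in> vedges_of D" for u w
    using that unfolding vedges_of_def by blast
  show ?thesis
    using assms unfolding joined_by_path_def
    by (induction rule: rtrancl_induct) (simp_all add: step)
qed

text \<open>Horizontal paths stay in a row and vertical paths in a column. Hence a vertex is
  determined by its two classes.\<close>

lemma joined_both_eq:
  "joined_by_path (hedges_of D) x y \<Longrightarrow> joined_by_path (vedges_of D) x y \<Longrightarrow> x = y"
  by (meson joined_hedges_fst joined_vedges_snd prod_eq_iff)

text \<open>Every edge lies inside \<open>verts_of D\<close>, so a vertex outside is joined only to
  itself.\<close>

lemma joined_verts_of:
  assumes "joined_by_path E x y" "\<And>e. e \<in> E \<Longrightarrow> e \<subseteq> verts_of D"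
  shows "x = y \<or> x \<in> verts_of D \<and> y \<in> verts_of D"
  using assms unfolding joined_by_path_def
  by (induction rule: rtrancl_induct) auto

lemma hedges_subset_verts: "e \<in> hedges_of D \<Longrightarrow> e \<subseteq> verts_of D"
proof -
  have "e \<in> minor_hedges d \<Longrightarrow> e \<subseteq> minor_verts d" for d by (cases d) auto
  then show "e \<in> hedges_of D \<Longrightarrow> e \<subseteq> verts_of D"
    unfolding hedges_of_def verts_of_def by blast
qed

lemma vedges_subset_verts: "e \<in> vedges_of D \<Longrightarrow> e \<subseteq> verts_of D"
proof -
  have "e \<in> minor_vedges d \<Longrightarrow> e \<subseteq> minor_verts d" for d by (cases d) auto
  then show "e \<in> vedges_of D \<Longrightarrow> e \<subseteq> verts_of D"
    unfolding vedges_of_def verts_of_def by blast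
qed

section \<open>Maximal intervals as classes of the path relation\<close>

lemma horizontal_interval_class:
  assumes "x \<in> verts_of D"
  shows "horizontal_interval D (Collect (joined_by_path (hedges_of D) x))"
  unfolding horizontal_interval_def
proof (intro conjI ballI exI)
  show "Collect (joined_by_path (hedges_of D) x) \<subseteq> verts_of D"
    using assms joined_verts_of hedges_subset_verts by blast
  show "fst y = fst x" if "y \<in> Collect (joined_by_path (hedges_of D) x)" for y
    using that joined_hedges_fst by fastforce
qed (blast intro: sym_joined trans_joined)

text \<open>All of \<open>H\<close> is joined to \<open>x\<close>, so \<open>H\<close> lies in the
  class of \<open>x\<close>; that class is an interval, and maximality of \<open>H\<close> gives
  equality.\<close>

lemma max_horizontal_eq:
  assumes "H \<in> max_horizontal_intervals D" "x \<in> H"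
  shows "H = Collect (joined_by_path (hedges_of D) x)"
proof
  have H: "horizontal_interval D H" "\<not> (\<exists>U. horizontal_interval D U \<and> H \<subset> U)"
    using assms(1) by (auto simp: max_horizontal_intervals_def)
  then show sub: "H \<subseteq> Collect (joined_by_path (hedges_of D) x)"
    using assms(2) by (auto simp: horizontal_interval_def)
  have "x \<in> verts_of D"
    using H(1) assms(2) by (auto simp: horizontal_interval_def)
  then have "horizontal_interval D (Collect (joined_by_path (hedges_of D) x))"
    by (rule horizontal_interval_class)
  with H(2) sub show "Collect (joined_by_path (hedges_of D) x) \<subseteq> H" by blast
qed

lemma vertical_interval_class:
  assumes "x \<in> verts_of D"
  shows "vertical_interval D (Collect (joined_by_path (vedges_of D) x))"
  unfolding vertical_interval_def
proof (intro conjI ballI exI)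
  show "Collect (joined_by_path (vedges_of D) x) \<subseteq> verts_of D"
    using assms joined_verts_of vedges_subset_verts by blast
  show "snd y = snd x" if "y \<in> Collect (joined_by_path (vedges_of D) x)" for y
    using that joined_vedges_snd by fastforce
qed (blast intro: sym_joined trans_joined)

lemma max_vertical_eq:
  assumes "H \<in> max_vertical_intervals D" "x \<in> H"
  shows "H = Collect (joined_by_path (vedges_of D) x)"
proof
  have H: "vertical_interval D H" "\<not> (\<exists>U. vertical_interval D U \<and> H \<subset> U)"
    using assms(1) by (auto simp: max_vertical_intervals_def)
  then show sub: "H \<subseteq> Collect (joined_by_path (vedges_of D) x)"
    using assms(2) by (auto simp: vertical_interval_def)
  have "x \<in> verts_of D"
    using H(1) assms(2) by (auto simp: vertical_interval_def)
  then have "vertical_interval D (Collect (joined_by_path (vedges_of D) x))"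
    by (rule vertical_interval_class)
  with H(2) sub show "Collect (joined_by_path (vedges_of D) x) \<subseteq> H" by blast
qed

lemma max_horizontal_class:
  assumes "x \<in> verts_of D"
  shows "Collect (joined_by_path (hedges_of D) x) \<in> max_horizontal_intervals D"
  unfolding max_horizontal_intervals_def
proof (intro CollectI conjI notI)
  let ?H = "Collect (joined_by_path (hedges_of D) x)"
  show "horizontal_interval D ?H"
    using assms by (rule horizontal_interval_class)
  assume "\<exists>U. horizontal_interval D U \<and> ?H \<subset> U"
  then obtain U where "horizontal_interval D U" "?H \<subset> U" by blast
  moreover have "x \<in> ?H" by simp
  ultimately show False unfolding horizontal_interval_def by blast
qed

lemma max_vertical_class:
  assumes "x \<in> verts_of D"
  shows "Collect (joined_by_path (vedges_of D) x) \<in> max_vertical_intervals D"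
  unfolding max_vertical_intervals_def
proof (intro CollectI conjI notI)
  let ?H = "Collect (joined_by_path (vedges_of D) x)"
  show "vertical_interval D ?H"
    using assms by (rule vertical_interval_class)
  assume "\<exists>U. vertical_interval D U \<and> ?H \<subset> U"
  then obtain U where "vertical_interval D U" "?H \<subset> U" by blast
  moreover have "x \<in> ?H" by simp
  ultimately show False unfolding vertical_interval_def by blast
qed

section \<open>Vertices met along a cycle\<close>

lemma graph_cycleD:
  assumes "graph_cycle D hs vs" "k < length hs"
  shows "cycle_out hs vs k \<in> hs ! k" "cycle_out hs vs k \<in> vs ! k"
    "cycle_in hs vs k \<in> hs ! (Suc k mod length hs)" "cycle_in hs vs k \<in> vs ! k"
    "cycle_out hs vs k \<in> verts_of D" "cycle_in hs vs k \<in> verts_of D"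
    "hs ! k \<in> max_horizontal_intervals D" "vs ! k \<in> max_vertical_intervals D"
proof -
  have e: "{Inl (hs ! k), Inr (vs ! k)} \<in> graph_edges D"
    "{Inl (hs ! (Suc k mod length hs)), Inr (vs ! k)} \<in> graph_edges D"
    using assms by (auto simp: graph_cycle_def insert_commute)
  have c: "crossing H X \<in> H \<inter> X" if "{Inl H, Inr X} \<in> graph_edges D" for H X
    using crossing[of D H X] graph_edgesD[OF that]
    by (auto simp: max_horizontal_intervals_def max_vertical_intervals_def)
  show "cycle_out hs vs k \<in> hs ! k" "cycle_out hs vs k \<in> vs ! k"
    "cycle_in hs vs k \<in> hs ! (Suc k mod length hs)" "cycle_in hs vs k \<in> vs ! k"
    using c[OF e(1)] c[OF e(2)] by (auto simp: cycle_out_def cycle_in_def)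
  show "cycle_out hs vs k \<in> verts_of D" "cycle_in hs vs k \<in> verts_of D"
    using crossing_in_verts[OF e(1)] crossing_in_verts[OF e(2)]
    by (auto simp: cycle_out_def cycle_in_def)
  show "hs ! k \<in> max_horizontal_intervals D" "vs ! k \<in> max_vertical_intervals D"
    using graph_edgesD[OF e(1)] by auto
qed

text \<open>Two consecutive vertices of the cycle lie in a common maximal interval, which is a
  single class by \<open>max_horizontal_eq\<close> or \<open>max_vertical_eq\<close>.\<close>

lemma graph_cycle_joined:
  assumes "graph_cycle D hs vs" "k < length hs"
  shows "joined_by_path (hedges_of D) (cycle_in hs vs k) (cycle_out hs vs (Suc k mod length hs))"
    and "joined_by_path (vedges_of D) (cycle_in hs vs k) (cycle_out hs vs k)"
proof -
  have "Suc k mod length hs < length hs" using assms(2) by (intro mod_less_divisor) linarith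
  then show "joined_by_path (hedges_of D) (cycle_in hs vs k) (cycle_out hs vs (Suc k mod length hs))"
    using graph_cycleD[OF assms] graph_cycleD[OF assms(1), of "Suc k mod length hs"]
      max_horizontal_eq by blast
  show "joined_by_path (vedges_of D) (cycle_in hs vs k) (cycle_out hs vs k)"
    using graph_cycleD[OF assms] max_vertical_eq by blast
qed

text \<open>The cyclic shift is injective on a finite set, hence bijective; it reindexes sums and
  products around a cycle.\<close>

lemma bij_Suc_mod: "bij_betw (\<lambda>k. Suc k mod r) {..<r} {..<r}"
proof -
  have "inj_on (\<lambda>k. Suc k mod r) {..<r}"
  proof (rule inj_onI)
    fix k l assume "k \<in> {..<r}" "l \<in> {..<r}" "Suc k mod r = Suc l mod r"
    then show "k = l"
      by (cases "Suc k = r"; cases "Suc l = r") auto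
  qed
  moreover have "(\<lambda>k. Suc k mod r) ` {..<r} \<subseteq> {..<r}" by auto
  ultimately show ?thesis
    by (simp add: bij_betw_def endo_inj_surj)
qed

lemma cycle_poly_eq:
  "cycle_poly hs vs = monomial (squarefree_monomial (cycle_out hs vs) (length hs))
     - monomial (squarefree_monomial (cycle_in hs vs) (length hs))"
  by (simp add: cycle_poly_def prod_indet)


section \<open>The toric parametrization\<close>

text \<open>
  Each vertex is sent to the product of a variable for its horizontal class and a variable for
  its vertical class. Vertices outside \<open>verts_of D\<close> form singleton classes, so they remain
  independent of all others. The variables are coded as natural numbers because the library
  proves polynomial rings to be integral domains only for linearly ordered variables.
\<close>

definition hcode :: "minor set \<Rightarrow> vertex \<Rightarrow> nat" where
  "hcode D x = to_nat (Inl (class_rep (hedges_of D) x) :: vertex + vertex)"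

definition vcode :: "minor set \<Rightarrow> vertex \<Rightarrow> nat" where
  "vcode D x = to_nat (Inr (class_rep (vedges_of D) x) :: vertex + vertex)"

lemma hcode_eq_iff: "hcode D x = hcode D y \<longleftrightarrow> joined_by_path (hedges_of D) x y"
  by (simp add: hcode_def class_rep_eq_iff)

lemma vcode_eq_iff: "vcode D x = vcode D y \<longleftrightarrow> joined_by_path (vedges_of D) x y"
  by (simp add: vcode_def class_rep_eq_iff)

lemma hcode_neq_vcode: "hcode D x \<noteq> vcode D y"
  by (simp add: hcode_def vcode_def)

lemma codes_eq: "hcode D x = hcode D y \<Longrightarrow> vcode D x = vcode D y \<Longrightarrow> x = y"
  by (simp add: hcode_eq_iff vcode_eq_iff joined_both_eq)

text \<open>Sharing a class with another vertex requires an edge, and edges lie in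
  \<open>verts_of D\<close>. This places the vertices of an alternating walk in
  \<open>verts_of D\<close>.\<close>

lemma vcode_verts: "vcode D x = vcode D y \<Longrightarrow> x \<noteq> y \<Longrightarrow> x \<in> verts_of D"
  using joined_verts_of vedges_subset_verts by (metis vcode_eq_iff)

definition toric_exp :: "minor set \<Rightarrow> (vertex \<Rightarrow>\<^sub>0 nat) \<Rightarrow> nat \<Rightarrow>\<^sub>0 nat" where
  "toric_exp D t = push (hcode D) t + push (vcode D) t"

lemma toric_exp_add: "toric_exp D (s + t) = toric_exp D s + toric_exp D t"
  by (simp add: toric_exp_def push_add add_ac)

text \<open>Horizontal and vertical variables are distinct and nothing cancels, so the support of
  the image splits into its two halves.\<close>

lemma toric_exp_codes:
  assumes "toric_exp D s = toric_exp D t"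
  shows "hcode D ` keys s = hcode D ` keys t" "vcode D ` keys s = vcode D ` keys t"
proof -
  have "hcode D ` keys s \<union> vcode D ` keys s = hcode D ` keys t \<union> vcode D ` keys t"
    using arg_cong[OF assms, of keys] by (simp add: toric_exp_def keys_add_nat keys_push_nat)
  moreover have "hcode D ` A \<inter> vcode D ` B = {}" for A B
    using hcode_neq_vcode by blast
  ultimately show "hcode D ` keys s = hcode D ` keys t" "vcode D ` keys s = vcode D ` keys t"
    by blast+
qed

text \<open>The vertical parts agree term by term, the horizontal parts after a cyclic shift of the
  indices.\<close>

lemma toric_exp_cycle:
  assumes "graph_cycle D hs vs"
  shows "toric_exp D (squarefree_monomial (cycle_out hs vs) (length hs)) =
    toric_exp D (squarefree_monomial (cycle_in hs vs) (length hs))"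
proof -
  let ?r = "length hs"
  have "(\<Sum>k<?r. Poly_Mapping.single (hcode D (cycle_in hs vs k)) (1::nat))
      = (\<Sum>k<?r. Poly_Mapping.single (hcode D (cycle_out hs vs (Suc k mod ?r))) 1)"
    using graph_cycle_joined(1)[OF assms] by (intro sum.cong) (simp_all flip: hcode_eq_iff)
  also have "\<dots> = (\<Sum>k<?r. Poly_Mapping.single (hcode D (cycle_out hs vs k)) 1)"
    by (rule sum.reindex_bij_betw[OF bij_Suc_mod])
  finally have "push (hcode D) (squarefree_monomial (cycle_in hs vs) ?r) =
      push (hcode D) (squarefree_monomial (cycle_out hs vs) ?r)"
    by (simp add: push_sum)
  moreover have "push (vcode D) (squarefree_monomial (cycle_in hs vs) ?r) =
      push (vcode D) (squarefree_monomial (cycle_out hs vs) ?r)"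
    using graph_cycle_joined(2)[OF assms] unfolding push_sum
    by (intro sum.cong) (simp_all flip: vcode_eq_iff)
  ultimately show ?thesis by (simp add: toric_exp_def)
qed

text \<open>The ring homomorphism that sets the variables in \<open>W\<close> to zero and sends
  every other one to the product of its two class variables.\<close>

definition toric_map ::
  "vertex set \<Rightarrow> minor set \<Rightarrow> 'k::field vpoly \<Rightarrow> (nat \<Rightarrow>\<^sub>0 nat) \<Rightarrow>\<^sub>0 'k" where
  "toric_map W D p = (\<Sum>t\<in>keys p.
     if keys t \<inter> W = {} then Poly_Mapping.single (toric_exp D t) (lookup p t) else 0)"

lemma toric_map_zero [simp]: "toric_map W D 0 = 0"
  by (simp add: toric_map_def)

lemma toric_map_single [simp]:
  "toric_map W D (Poly_Mapping.single t c) =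
     (if keys t \<inter> W = {} then Poly_Mapping.single (toric_exp D t) c else 0)"
  by (simp add: toric_map_def)

lemma toric_map_add: "toric_map W D (p + q) = toric_map W D p + toric_map W D q"
  unfolding toric_map_def by (rule setsum_keys_plus_distrib) (simp_all add: single_add)

lemma toric_map_diff: "toric_map W D (p - q) = toric_map W D p - toric_map W D q"
  using toric_map_add[of W D "p - q" q] by (simp add: algebra_simps)

lemma toric_map_sum: "toric_map W D (\<Sum>k\<in>A. f k) = (\<Sum>k\<in>A. toric_map W D (f k))"
  by (induction A rule: infinite_finite_induct) (simp_all add: toric_map_add)

text \<open>Both sides are bilinear, so single terms suffice; there exponents add, and a product
  meets \<open>W\<close> iff one of its factors does.\<close>

lemma toric_map_mult: "toric_map W D (p * q) = toric_map W D p * toric_map W D q"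
proof -
  have single: "toric_map W D (Poly_Mapping.single s a * Poly_Mapping.single t b) =
      toric_map W D (Poly_Mapping.single s a) * toric_map W D (Poly_Mapping.single t b)" for s t a b
    by (auto simp: mult_single toric_exp_add keys_add_nat)
  have "p * q = (\<Sum>s\<in>keys p. \<Sum>t\<in>keys q.
      Poly_Mapping.single s (lookup p s) * Poly_Mapping.single t (lookup q t))"
    by (simp flip: sum_product poly_mapping_sum_single)
  then have "toric_map W D (p * q) = (\<Sum>s\<in>keys p. toric_map W D (Poly_Mapping.single s (lookup p s)))
      * (\<Sum>t\<in>keys q. toric_map W D (Poly_Mapping.single t (lookup q t)))"
    by (simp only: toric_map_sum single sum_product)
  then show ?thesis
    by (simp only: flip: toric_map_sum poly_mapping_sum_single)
qed

lemma single_eq_0_iff: "Poly_Mapping.single t c = 0 \<longleftrightarrow> c = 0"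
  by (metis lookup_single_eq lookup_zero single_zero)

definition toric_kernel :: "vertex set \<Rightarrow> vertex set \<Rightarrow> minor set \<Rightarrow> 'k::field vpoly set" where
  "toric_kernel U W D = {p \<in> carrier (poly_ring U). toric_map W D p = 0}"

lemma ideal_toric_kernel: "ideal (toric_kernel U W D) (poly_ring U)"
  by (rule ideal_poly_ringI)
    (auto simp: toric_kernel_def toric_map_add toric_map_mult zero_closed poly_ring_closed)

text \<open>The codomain is a polynomial ring over a field in variables indexed by
  \<open>nat\<close>, hence an integral domain, and \<open>1\<close> is not in the kernel.\<close>

lemma primeideal_toric_kernel: "primeideal (toric_kernel U W D) (poly_ring U)"
proof (rule primeidealI)
  have "toric_map W D 1 \<noteq> 0"
    by (simp add: single_eq_0_iff flip: single_one)
  then show "carrier (poly_ring U) \<noteq> toric_kernel U W D"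
    using one_closed unfolding toric_kernel_def by blast
qed (rule ideal_toric_kernel cring_poly_ring | auto simp: toric_kernel_def toric_map_mult)+

lemma indet_in_toric_kernel: "x \<in> U \<Longrightarrow> indet x \<in> toric_kernel U W D \<longleftrightarrow> x \<in> W"
  using indet_closed[of x U] by (auto simp: toric_kernel_def indet_def single_eq_0_iff)

lemma toric_map_cycle_poly:
  assumes "graph_cycle D hs vs" "verts_of D \<inter> W = {}"
  shows "toric_map W D (cycle_poly hs vs) = 0"
proof -
  have "keys (squarefree_monomial (cycle_out hs vs) (length hs)) \<inter> W = {}"
    "keys (squarefree_monomial (cycle_in hs vs) (length hs)) \<inter> W = {}"
    using assms(2) graph_cycleD(5,6)[OF assms(1)] unfolding keys_squarefree_monomial by blast+
  then show ?thesis
    by (simp add: cycle_poly_eq toric_map_diff toric_exp_cycle[OF assms(1)] del: One_nat_def)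
qed


section \<open>Binomials in the kernel\<close>

text \<open>
  The maps \<open>n2\<close> and \<open>n1\<close> choose, for a horizontal (vertical) class, a vertex of it in \<open>X\<close>
  (in \<open>Y\<close>). Alternating between them defines a self-map \<open>s\<close> of a finite set of horizontal
  classes, and a shortest orbit of \<open>s\<close> is a cycle.
\<close>

lemma alternating_cycle:
  fixes X Y :: "vertex set"
  assumes "finite X" "X \<noteq> {}" "X \<inter> Y = {}"
    and hY: "hcode D ` X = hcode D ` Y" and vY: "vcode D ` X = vcode D ` Y"
  obtains hs vs where "graph_cycle D hs vs"
    "cycle_out hs vs ` {..<length hs} \<subseteq> X" "inj_on (cycle_out hs vs) {..<length hs}"
    "cycle_in hs vs 0 \<in> Y"
proof -
  have "\<exists>n2. \<forall>a\<in>hcode D ` X. n2 a \<in> X \<and> hcode D (n2 a) = a"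
    by (intro bchoice) blast
  then obtain n2 where n2: "n2 a \<in> X" "hcode D (n2 a) = a" if "a \<in> hcode D ` X" for a
    by blast
  have "\<exists>n1. \<forall>b\<in>vcode D ` X. n1 b \<in> Y \<and> vcode D (n1 b) = b"
    unfolding vY by (intro bchoice) blast
  then obtain n1 where n1: "n1 b \<in> Y" "vcode D (n1 b) = b" if "b \<in> vcode D ` X" for b
    by blast
  define s where "s a = hcode D (n1 (vcode D (n2 a)))" for a
  obtain x0 where "x0 \<in> X" using assms(2) by blast
  define a where "a k = (s ^^ k) (hcode D x0)" for k
  define x where "x k = n2 (a k)" for k
  define y where "y k = n1 (vcode D (x k))" for k
  have s_closed: "s b \<in> hcode D ` X" if "b \<in> hcode D ` X" for b
    using n1(1) n2(1)[OF that] unfolding s_def hY by blast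
  have a: "a k \<in> hcode D ` X" for k
    by (induction k) (use \<open>x0 \<in> X\<close> s_closed in \<open>auto simp: a_def\<close>)
  have x: "x k \<in> X" "hcode D (x k) = a k" for k
    using n2[OF a] by (auto simp: x_def)
  have y: "y k \<in> Y" "vcode D (y k) = vcode D (x k)" "hcode D (y k) = a (Suc k)" for k
  proof -
    have "vcode D (x k) \<in> vcode D ` X" using x(1) by blast
    then show "y k \<in> Y" "vcode D (y k) = vcode D (x k)"
      unfolding y_def by (fact n1)+
    show "hcode D (y k) = a (Suc k)"
      by (simp add: y_def x_def a_def s_def)
  qed
  have xy: "x k \<noteq> y l" for k l
    using x(1)[of k] y(1)[of l] assms(3) by auto
  \<comment> \<open>\<open>x k\<close> and \<open>y k\<close> are distinct but share a vertical
    class, so both are ends of edges of \<open>D\<close>.\<close>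
  have xD: "x k \<in> verts_of D" and yD: "y k \<in> verts_of D" for k
    using vcode_verts[of D "x k" "y k"] vcode_verts[of D "y k" "x k"] y(2)[of k] xy[of k k]
    by simp_all
  have "finite (range a)"
    using a assms(1) by (intro finite_subset[of "range a" "hcode D ` X"]) auto
  then have "\<not> inj a"
    using finite_imageD[of a UNIV] infinite_UNIV_nat by blast
  then obtain i0 j0 where "a i0 = a j0" "i0 \<noteq> j0"
    unfolding inj_def by blast
  then obtain p q where "a p = a q" "p < q"
    by (cases i0 j0 rule: linorder_cases) metis+
  then have ex: "\<exists>r i. 0 < r \<and> a i = a (i + r)"
    by (intro exI[of _ "q - p"] exI[of _ p]) simp
  \<comment> \<open>\<open>r\<close> is the least return time over all starting points, not only
    over one. Hence the classes at any \<open>r\<close> consecutive indices are distinct.\<close>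
  define r where "r = (LEAST r. \<exists>i. 0 < r \<and> a i = a (i + r))"
  have "\<exists>i. 0 < r \<and> a i = a (i + r)"
    unfolding r_def using ex by (rule LeastI_ex)
  then obtain i where r: "0 < r" "a i = a (i + r)" by blast
  have min: False if "a p = a q" "p < q" "q < p + r" for p q
  proof -
    have "\<exists>i. 0 < q - p \<and> a i = a (i + (q - p))"
      using that by (intro exI[of _ p]) simp
    then have "r \<le> q - p" unfolding r_def by (rule Least_le)
    with that(2,3) show False by simp
  qed
  have a_inj: "k = l" if "k < r" "l < r" "a (i + k) = a (i + l)" for k l
  proof (cases k l rule: linorder_cases)
    case less
    then have False using that(2) by (intro min[OF that(3)]) linarith+
    then show ?thesis ..
  next
    case greater
    then have False using that(1) by (intro min[OF that(3)[symmetric]]) linarith+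
    then show ?thesis ..
  qed
  \<comment> \<open>At the last index the wrap to 0 is the return of the orbit after
    \<open>r\<close> steps.\<close>
  have a_mod: "a (i + Suc k mod r) = a (i + Suc k)" if "k < r" for k
  proof (cases "Suc k = r")
    case True
    then show ?thesis using r(2) by (simp only: mod_self add_0_right)
  next
    case False
    with that have "Suc k mod r = Suc k" by (intro mod_less) linarith
    then show ?thesis by (simp only:)
  qed
  have mod_less: "Suc k mod r < r" for k
    using r(1) by (rule mod_less_divisor)
  have v_inj: "k = l" if "k < r" "l < r" "vcode D (x (i + k)) = vcode D (x (i + l))" for k l
  proof -
    \<comment> \<open>\<open>y\<close> depends only on the vertical class of \<open>x\<close>, so
      equal vertical classes lead to equal next horizontal classes.\<close>
    have eq: "a (i + Suc k) = a (i + Suc l)"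
      using y(3)[of "i + k"] y(3)[of "i + l"] that(3) by (simp add: y_def)
    have "Suc k mod r = Suc l mod r"
      by (rule a_inj[OF mod_less mod_less]) (simp only: a_mod that(1,2) eq)
    then show ?thesis
      using that(1,2) by (rule inj_onD[OF bij_betw_imp_inj_on[OF bij_Suc_mod], unfolded lessThan_iff])
  qed
  \<comment> \<open>With period 1, \<open>x i\<close> and \<open>y i\<close> would share both
    classes and coincide, against the disjointness of \<open>X\<close> and \<open>Y\<close>.\<close>
  have "r \<noteq> 1"
  proof
    assume "r = 1"
    then have "hcode D (y i) = hcode D (x i)"
      using r(2) x(2)[of i] y(3)[of i] by simp
    then have "y i = x i" using y(2) by (rule codes_eq)
    with xy[of i i] show False by simp
  qed
  with r(1) have "2 \<le> r" by simp
  define H where "H z = Collect (joined_by_path (hedges_of D) z)" for z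
  define X' where "X' z = Collect (joined_by_path (vedges_of D) z)" for z
  have H_eq: "H z = H z'" if "hcode D z = hcode D z'" for z z'
    using that sym_joined trans_joined unfolding hcode_eq_iff H_def by blast
  have X_eq: "X' z = X' z'" if "vcode D z = vcode D z'" for z z'
    using that sym_joined trans_joined unfolding vcode_eq_iff X'_def by blast
  have mem: "z \<in> H z" "z \<in> X' z" for z
    by (auto simp: H_def X'_def)
  have maxs: "H z \<in> max_horizontal_intervals D" "X' z \<in> max_vertical_intervals D"
    if "z \<in> verts_of D" for z
    using that max_horizontal_class max_vertical_class by (auto simp: H_def X'_def)
  have edge: "{Inl (H z), Inr (X' z)} \<in> graph_edges D" if "z \<in> verts_of D" for z
    using maxs[OF that] mem unfolding graph_edges_def by blast
  have cross: "crossing (H z) (X' z) = z" for z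
  proof -
    have "H z \<inter> X' z = {z}"
      using joined_both_eq[of D z] refl_joined unfolding H_def X'_def by blast
    then show ?thesis by (simp add: crossing_def)
  qed
  define hs where "hs = map (\<lambda>k. H (x (i + k))) [0..<r]"
  define vs where "vs = map (\<lambda>k. X' (x (i + k))) [0..<r]"
  have len: "length hs = r" "length vs = r" by (simp_all add: hs_def vs_def)
  have hs: "hs ! k = H (x (i + k))" and vs: "vs ! k = X' (x (i + k))" if "k < r" for k
    using that by (simp_all add: hs_def vs_def)
  \<comment> \<open>The same intervals seen from the \<open>y\<close> vertices, which are therefore
    the crossings on the way back.\<close>
  have hs': "hs ! (Suc k mod r) = H (y (i + k))" and vs': "vs ! k = X' (y (i + k))" if "k < r" for k
  proof -
    show "hs ! (Suc k mod r) = H (y (i + k))"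
      unfolding hs[OF mod_less] by (intro H_eq) (simp add: x(2) y(3) a_mod[OF that])
    show "vs ! k = X' (y (i + k))"
      unfolding vs[OF that] by (intro X_eq) (simp add: y(2))
  qed
  have H_inj: "hcode D z = hcode D z'" if "H z = H z'" for z z'
    using that mem(1)[of z'] by (auto simp: H_def hcode_eq_iff)
  have X_inj: "vcode D z = vcode D z'" if "X' z = X' z'" for z z'
    using that mem(2)[of z'] by (auto simp: X'_def vcode_eq_iff)
  have "distinct hs" "distinct vs"
    unfolding hs_def vs_def distinct_map
    by (auto intro!: inj_onI dest!: H_inj X_inj simp: x(2) dest: a_inj v_inj)
  then have cyc: "graph_cycle D hs vs"
    unfolding graph_cycle_def len
  proof (intro conjI allI impI)
    show "set hs \<subseteq> max_horizontal_intervals D" "set vs \<subseteq> max_vertical_intervals D"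
      using maxs[OF xD] by (auto simp: hs_def vs_def)
    fix k assume k: "k < r"
    show "{Inl (hs ! k), Inr (vs ! k)} \<in> graph_edges D"
      using edge[OF xD] by (simp add: hs vs k)
    show "{Inr (vs ! k), Inl (hs ! (Suc k mod r))} \<in> graph_edges D"
      using edge[OF yD] by (simp add: hs'[OF k] vs'[OF k] insert_commute)
  qed (use \<open>2 \<le> r\<close> in simp_all)
  have out: "cycle_out hs vs k = x (i + k)" if "k < r" for k
    using that by (simp add: cycle_out_def hs vs cross)
  have "cycle_in hs vs 0 = y i"
    using hs'[OF r(1)] vs'[OF r(1)] by (simp add: cycle_in_def len cross)
  show ?thesis
  proof (rule that[OF cyc])
    show "cycle_out hs vs ` {..<length hs} \<subseteq> X"
      using out x(1) len by auto
    show "inj_on (cycle_out hs vs) {..<length hs}"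
      using out v_inj len by (auto intro!: inj_onI)
    show "cycle_in hs vs 0 \<in> Y"
      using \<open>cycle_in hs vs 0 = y i\<close> y(1) by simp
  qed
qed

text \<open>Induction on the degree. A common variable is cancelled. If the supports are disjoint, a
  cycle with outgoing vertices in \<open>s\<close> rewrites \<open>s\<close> modulo \<open>I\<close>
  into a monomial that shares a variable with \<open>t\<close>.\<close>

lemma monomial_diff_in_ideal:
  fixes I :: "'k::field vpoly set"
  assumes I: "ideal I (poly_ring U)"
    and cyc: "\<And>hs vs. graph_cycle D hs vs \<Longrightarrow> cycle_poly hs vs \<in> I"
    and DU: "verts_of D \<subseteq> U"
  shows "keys s \<subseteq> U \<Longrightarrow> keys t \<subseteq> U \<Longrightarrow> toric_exp D s = toric_exp D t \<Longrightarrow>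
    monomial s - monomial t \<in> I"
proof (induction "deg t" arbitrary: s t rule: less_induct)
  case less
  \<comment> \<open>The induction measures only \<open>t\<close>, so the first monomial may be
    \<open>s\<close> itself or the one obtained from it by a cycle.\<close>
  have cancel: "monomial (Poly_Mapping.single x 1 + s') - monomial (Poly_Mapping.single x 1 + t') \<in> I"
    if "Poly_Mapping.single x 1 + t' = t" "keys s' \<subseteq> U"
      "toric_exp D (Poly_Mapping.single x 1 + s') = toric_exp D t" for x s' t'
  proof -
    have keys: "x \<in> U" "keys t' \<subseteq> U"
      using less.prems(2) unfolding that(1)[symmetric] keys_add_nat by auto
    have "toric_exp D s' = toric_exp D t'"
      using that(3) unfolding that(1)[symmetric] toric_exp_add by simp
    moreover have "deg t' < deg t"
      unfolding that(1)[symmetric] deg_add by simp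
    ultimately have "monomial s' - monomial t' \<in> I"
      using that(2) keys(2) by (intro less.hyps)
    then have "indet x * (monomial s' - monomial t') \<in> I"
      using I keys(1) by (intro ideal_mult indet_closed)
    then show ?thesis
      by (simp add: indet_def right_diff_distrib mult_single)
  qed
  show ?case
  proof (cases "keys s \<inter> keys t = {}")
    case False
    then obtain x where "x \<in> keys s" "x \<in> keys t" by blast
    then obtain s' t' where st: "s = Poly_Mapping.single x 1 + s'" "t = Poly_Mapping.single x 1 + t'"
      by (metis split_key_nat)
    have "keys s' \<subseteq> U"
      using less.prems(1) unfolding st keys_add_nat by simp
    then show ?thesis
      using cancel[of x t' s'] less.prems(3) st by simp
  next
    case disjoint: True
    show ?thesis
    proof (cases "s = 0")
      case True
      then have "t = 0"
        using toric_exp_codes(1)[OF less.prems(3)] by (metis image_is_empty keys_eq_empty)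
      then show ?thesis using True ideal_zero[OF I] by simp
    next
      case False
      then obtain hs vs where c: "graph_cycle D hs vs"
        "cycle_out hs vs ` {..<length hs} \<subseteq> keys s" "inj_on (cycle_out hs vs) {..<length hs}"
        "cycle_in hs vs 0 \<in> keys t"
        using alternating_cycle[OF _ _ disjoint toric_exp_codes[OF less.prems(3)]] by auto
      define mo where "mo = squarefree_monomial (cycle_out hs vs) (length hs)"
      define mi where "mi = squarefree_monomial (cycle_in hs vs) (length hs)"
      obtain w where w: "s = mo + w"
        using split_squarefree[OF c(3,2)] unfolding mo_def by blast
      have wU: "keys w \<subseteq> U"
        using less.prems(1) unfolding w keys_add_nat by simp
      have miU: "keys mi \<subseteq> U"
        using graph_cycleD(6)[OF c(1)] DU unfolding mi_def keys_squarefree_monomial by blast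
      have len: "0 < length hs" using c(1) unfolding graph_cycle_def by linarith
      \<comment> \<open>The factor \<open>mo\<close> of \<open>s\<close> is exchanged for
        \<open>mi\<close> by a monomial multiple of the cycle binomial.\<close>
      have 1: "monomial s - monomial (mi + w) \<in> I"
      proof -
        have "monomial w * cycle_poly hs vs \<in> I"
          using I wU cyc[OF c(1)] by (intro ideal_mult monomial_closed)
        then show ?thesis
          by (simp add: cycle_poly_eq right_diff_distrib mult_single w mo_def mi_def add.commute)
      qed
      \<comment> \<open>This variable occurs in both \<open>mi + w\<close> and \<open>t\<close>, so
        \<open>cancel\<close> applies to them.\<close>
      have "cycle_in hs vs 0 \<in> keys (mi + w)"
        using len unfolding keys_add_nat mi_def keys_squarefree_monomial by blast
      then obtain s' where s': "mi + w = Poly_Mapping.single (cycle_in hs vs 0) 1 + s'"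
        by (rule split_key_nat)
      obtain t' where t': "t = Poly_Mapping.single (cycle_in hs vs 0) 1 + t'"
        using c(4) by (rule split_key_nat)
      have "keys (mi + w) \<subseteq> U" using miU wU by (simp add: keys_add_nat)
      then have "keys s' \<subseteq> U" unfolding s' keys_add_nat by simp
      moreover have "toric_exp D (mi + w) = toric_exp D t"
        using toric_exp_cycle[OF c(1)] less.prems(3)
        unfolding w mo_def[symmetric] mi_def[symmetric] toric_exp_add by simp
      ultimately have "monomial (mi + w) - monomial t \<in> I"
        using cancel[of "cycle_in hs vs 0" t' s'] s' t' by simp
      from ideal_add[OF I 1 this] show ?thesis by simp
    qed
  qed
qed

text \<open>Modulo \<open>I\<close> a term is congruent to one on a chosen monomial with the same
  toric image, or to 0 if it meets \<open>W\<close>. So \<open>p\<close> is congruent to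
  \<open>push rep\<close> of its image, which is 0.\<close>

lemma toric_kernel_subset_ideal:
  fixes I :: "'k::field vpoly set"
  assumes I: "ideal I (poly_ring U)"
    and cyc: "\<And>hs vs. graph_cycle D hs vs \<Longrightarrow> cycle_poly hs vs \<in> I"
    and DU: "verts_of D \<subseteq> U"
    and W: "indet ` W \<subseteq> I"
  shows "toric_kernel U W D \<subseteq> I"
proof
  fix p :: "'k vpoly"
  assume "p \<in> toric_kernel U W D"
  then have p: "\<And>t. t \<in> keys p \<Longrightarrow> keys t \<subseteq> U" "toric_map W D p = 0"
    by (auto simp: toric_kernel_def carrier_poly_ring)
  define rep where "rep e = (SOME t. keys t \<subseteq> U \<and> toric_exp D t = e)" for e
  have rep: "keys (rep (toric_exp D t)) \<subseteq> U" "toric_exp D (rep (toric_exp D t)) = toric_exp D t"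
    if "keys t \<subseteq> U" for t
    using someI[of "\<lambda>u. keys u \<subseteq> U \<and> toric_exp D u = toric_exp D t" t] that
    by (auto simp: rep_def)
  have "Poly_Mapping.single t c - push rep (toric_map W D (Poly_Mapping.single t c)) \<in> I"
    if t: "keys t \<subseteq> U" for t c
  proof (cases "keys t \<inter> W = {}")
    case True
    have "Poly_Mapping.single 0 c * (monomial t - monomial (rep (toric_exp D t))) \<in> I"
      using t rep[OF t] by (intro ideal_mult[OF I] monomial_diff_in_ideal[OF I cyc DU] monomial_closed) auto
    then show ?thesis using True by (simp add: right_diff_distrib mult_single)
  next
    case False
    then obtain x where x: "x \<in> keys t" "x \<in> W" by blast
    from x(1) obtain r where r: "t = Poly_Mapping.single x 1 + r" by (rule split_key_nat)
    have "Poly_Mapping.single r c * indet x \<in> I"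
      using t W x(2) unfolding r keys_add_nat by (intro ideal_mult[OF I] monomial_closed) auto
    then show ?thesis using False by (simp add: indet_def mult_single r add.commute)
  qed
  then have "(\<Sum>t\<in>keys p. Poly_Mapping.single t (lookup p t)
      - push rep (toric_map W D (Poly_Mapping.single t (lookup p t)))) \<in> I"
    using p(1) by (intro ideal_sum[OF I]) blast
  then have "p - push rep (toric_map W D p) \<in> I"
    by (simp only: sum_subtractf flip: push_sum toric_map_sum poly_mapping_sum_single)
  then show "p \<in> I" by (simp add: p(2))
qed


section \<open>The ideals of admissible sets\<close>

lemma cycle_polys_closed:
  assumes "D \<subseteq> C"
  shows "{cycle_poly hs vs | hs vs. graph_cycle D hs vs} \<subseteq> carrier (poly_ring (verts_of C))"
  using cycle_poly_closed[OF _ assms] unfolding ambient_ring_def by blast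

lemma cycle_ideal:
  assumes "D \<subseteq> C"
  shows "ideal (cycle_ideal C D) (poly_ring (verts_of C))"
    and "graph_cycle D hs vs \<Longrightarrow> cycle_poly hs vs \<in> cycle_ideal C D"
  using genideal_poly_ring[OF cycle_polys_closed[OF assms]]
  unfolding cycle_ideal_def ambient_ring_def by blast+

lemma cycle_ideal_subset:
  assumes "ideal I (poly_ring (verts_of C))"
    and "\<And>hs vs. graph_cycle D hs vs \<Longrightarrow> cycle_poly hs vs \<in> I"
  shows "cycle_ideal C D \<subseteq> I"
  using assms unfolding cycle_ideal_def ambient_ring_def by (intro genideal_poly_ring_le) auto

lemma cycle_poly_in_toric_kernel:
  assumes "graph_cycle D hs vs" "D \<subseteq> C" "verts_of D \<inter> W = {}"
  shows "cycle_poly hs vs \<in> toric_kernel (verts_of C) W D"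
  using assms cycle_poly_closed[OF assms(1,2)] toric_map_cycle_poly[OF assms(1,3)]
  by (simp add: toric_kernel_def ambient_ring_def)

text \<open>With no variable set to zero, membership in a cycle ideal becomes vanishing under the
  toric map.\<close>

lemma cycle_ideal_eq_toric_kernel:
  assumes "D \<subseteq> C"
  shows "cycle_ideal C D = toric_kernel (verts_of C) {} D"
proof
  show "cycle_ideal C D \<subseteq> toric_kernel (verts_of C) {} D"
    using assms by (intro cycle_ideal_subset ideal_toric_kernel cycle_poly_in_toric_kernel) auto
  show "toric_kernel (verts_of C) {} D \<subseteq> cycle_ideal C D"
    using assms by (intro toric_kernel_subset_ideal cycle_ideal verts_of_mono) auto
qed

lemma avoiding_subset: "avoiding C W \<subseteq> C"
  by (auto simp: avoiding_def)

lemma verts_of_avoiding: "verts_of (avoiding C W) \<inter> W = {}"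
  by (auto simp: avoiding_def verts_of_def)

lemma set_add_poly_ring: "I <+>\<^bsub>poly_ring U\<^esub> J = {p + q | p q. p \<in> I \<and> q \<in> J}"
  by (auto simp: set_add_def set_mult_def)

lemma admissible_ideal_subset:
  assumes I: "ideal I (poly_ring (verts_of C))" and "indet ` W \<subseteq> I"
    and "\<And>hs vs. graph_cycle (avoiding C W) hs vs \<Longrightarrow> cycle_poly hs vs \<in> I"
  shows "admissible_ideal C W \<subseteq> I"
  using cycle_ideal_subset[OF I assms(3)] genideal_poly_ring_le[OF I assms(2)] ideal_add[OF I]
  unfolding admissible_ideal_def ambient_ring_def set_add_poly_ring by blast

text \<open>The generators vanish under the toric map; conversely
  \<open>toric_kernel_subset_ideal\<close> applies to the sum of ideals itself.\<close>

lemma admissible_ideal_eq_toric_kernel: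
  assumes "W \<subseteq> verts_of C"
  shows "(admissible_ideal C W :: 'k::field vpoly set) = toric_kernel (verts_of C) W (avoiding C W)"
proof
  let ?D = "avoiding C W"
  have W: "indet ` W \<subseteq> (carrier (poly_ring (verts_of C)) :: 'k vpoly set)"
    using assms indet_closed by blast
  note gen = genideal_poly_ring[OF W] and cyc = cycle_ideal[OF avoiding_subset]
  show "admissible_ideal C W \<subseteq> (toric_kernel (verts_of C) W ?D :: 'k vpoly set)"
    using assms
    by (intro admissible_ideal_subset ideal_toric_kernel cycle_poly_in_toric_kernel
        avoiding_subset verts_of_avoiding) (auto simp: indet_in_toric_kernel)
  have "ideal (admissible_ideal C W :: 'k vpoly set) (poly_ring (verts_of C))"
    unfolding admissible_ideal_def ambient_ring_def
    by (intro ring.add_ideals[OF cring.axioms(1)[OF cring_poly_ring]] gen(1) cyc(1))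
  moreover have "indet ` W \<subseteq> (admissible_ideal C W :: 'k vpoly set)"
  proof -
    have "p + 0 \<in> admissible_ideal C W" if "p \<in> indet ` W" for p :: "'k vpoly"
      using that gen(2) ideal_zero[OF cyc(1)]
      unfolding admissible_ideal_def ambient_ring_def set_add_poly_ring by blast
    then show ?thesis by auto
  qed
  moreover have "cycle_poly hs vs \<in> (admissible_ideal C W :: 'k vpoly set)"
    if "graph_cycle ?D hs vs" for hs vs
  proof -
    have "0 + cycle_poly hs vs \<in> (admissible_ideal C W :: 'k vpoly set)"
      using cyc(2)[OF that] ideal_zero[OF gen(1)]
      unfolding admissible_ideal_def ambient_ring_def set_add_poly_ring by blast
    then show ?thesis by simp
  qed
  ultimately show "(toric_kernel (verts_of C) W ?D :: 'k vpoly set) \<subseteq> admissible_ideal C W"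
    by (intro toric_kernel_subset_ideal verts_of_mono avoiding_subset)
qed

lemma minor_poly_eq:
  "minor_poly (Minor a1 a2 b1 b2) =
     monomial (Poly_Mapping.single (a1, b1) 1 + Poly_Mapping.single (a2, b2) 1)
     - monomial (Poly_Mapping.single (a1, b2) 1 + Poly_Mapping.single (a2, b1) 1)"
  by (simp add: indet_def mult_single)

text \<open>If the minor avoids \<open>W\<close>, its edges identify the class variables in pairs
  and both terms have the same image. Otherwise an edge lies in \<open>W\<close>; it has one vertex
  on each diagonal, so both terms are sent to 0.\<close>

lemma minor_in_toric_kernel:
  assumes "admissible C W" "d \<in> C"
  shows "minor_poly d \<in> toric_kernel (verts_of C) W (avoiding C W)"
proof -
  obtain a1 a2 b1 b2 where d: "d = Minor a1 a2 b1 b2" by (cases d)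
  have "toric_map W (avoiding C W) (minor_poly d) = 0"
  proof (cases "W \<inter> minor_verts d = {}")
    case True
    let ?D = "avoiding C W"
    have dD: "d \<in> ?D" using True assms(2) by (auto simp: avoiding_def)
    have "{(a1, b1), (a1, b2)} \<in> hedges_of ?D" "{(a2, b1), (a2, b2)} \<in> hedges_of ?D"
      "{(a1, b1), (a2, b1)} \<in> vedges_of ?D" "{(a1, b2), (a2, b2)} \<in> vedges_of ?D"
      using dD by (auto simp: hedges_of_def vedges_of_def d intro!: bexI[of _ d])
    then have "hcode ?D (a1, b1) = hcode ?D (a1, b2)" "hcode ?D (a2, b1) = hcode ?D (a2, b2)"
      "vcode ?D (a1, b1) = vcode ?D (a2, b1)" "vcode ?D (a1, b2) = vcode ?D (a2, b2)"
      by (simp_all add: hcode_eq_iff vcode_eq_iff edge_joined)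
    then have "toric_exp ?D (Poly_Mapping.single (a1, b1) 1 + Poly_Mapping.single (a2, b2) 1)
        = toric_exp ?D (Poly_Mapping.single (a1, b2) 1 + Poly_Mapping.single (a2, b1) 1)"
      by (simp add: toric_exp_def push_add add_ac)
    then show ?thesis
      using True unfolding d minor_poly_eq toric_map_diff
      by (simp add: keys_add_nat Int_commute)
  next
    case False
    then obtain e where "e \<in> minor_edges d" "e \<subseteq> W"
      using assms unfolding admissible_def by blast
    then have "((a1, b1) \<in> W \<or> (a2, b2) \<in> W) \<and> ((a1, b2) \<in> W \<or> (a2, b1) \<in> W)"
      by (auto simp: minor_edges_def d)
    then show ?thesis
      unfolding d minor_poly_eq toric_map_diff by (auto simp: keys_add_nat)
  qed
  then show ?thesis
    using minor_poly_closed[OF assms(2)] by (simp add: toric_kernel_def ambient_ring_def)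
qed

lemma minor_ideal_subset_iff:
  assumes "ideal I (poly_ring (verts_of C))"
  shows "minor_ideal C \<subseteq> I \<longleftrightarrow> minor_poly ` C \<subseteq> I"
proof -
  have "minor_poly ` C \<subseteq> minor_ideal C"
    using minor_poly_closed unfolding minor_ideal_def ambient_ring_def
    by (intro genideal_poly_ring(2)) blast
  then show ?thesis
    using genideal_poly_ring_le[OF assms] unfolding minor_ideal_def ambient_ring_def by blast
qed


section \<open>Primes containing the ideal of minors\<close>

text \<open>
  In a corner-interval minor the column \<open>1\<close> entries of the two rows are always present, so modulo a
  prime \<open>Q\<close> containing none of the vertices, the quotient of an entry by the column \<open>1\<close> entry of its
  row is constant along each vertical interval. This is where the corner-interval hypothesis enters.
\<close>

lemma vertical_ratio:
  fixes Q :: "'k::field vpoly set"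
  assumes Q: "primeideal Q (poly_ring U)"
    and D: "\<forall>d\<in>D. corner_interval d" "minor_poly ` D \<subseteq> Q"
    and U: "verts_of D \<subseteq> U" and nQ: "\<forall>x\<in>verts_of D. indet x \<notin> Q"
    and xD: "x \<in> verts_of D"
    and "joined_by_path (vedges_of D) x y"
  shows "y \<in> verts_of D \<and> (fst y, 1) \<in> verts_of D \<and>
    indet x * indet (fst y, 1) - indet y * indet (fst x, 1) \<in> Q"
proof -
  have I: "ideal Q (poly_ring U)" using Q by (rule primeideal.axioms)
  have corner: "(fst z, 1) \<in> verts_of D" if z: "z \<in> verts_of D" for z
  proof -
    obtain d where "d \<in> D" "z \<in> minor_verts d"
      using z unfolding verts_of_def by blast
    then show ?thesis
      using D(1) by (cases d) (force simp: verts_of_def)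
  qed
  have edge: "indet y * indet (fst z, 1) - indet z * indet (fst y, 1) \<in> Q"
    if yz: "{y, z} \<in> vedges_of D" for y z
  proof -
    obtain d where d: "d \<in> D" "{y, z} \<in> minor_vedges d"
      using yz by (auto simp: vedges_of_def)
    obtain a1 a2 b where d_eq: "d = Minor a1 a2 1 b"
      using D(1) d(1) by (cases d) auto
    have f: "indet (a1, 1) * indet (a2, b) - indet (a1, b) * indet (a2, 1) \<in> Q"
    proof -
      have "minor_poly d \<in> Q" using D(2) d(1) by blast
      then show ?thesis by (simp only: d_eq minor_poly.simps)
    qed
    have f': "indet (a1, b) * indet (a2, 1) - indet (a2, b) * indet (a1, 1) \<in> Q"
      using ideal_diff[OF I ideal_zero[OF I] f] by (simp add: mult.commute)
    \<comment> \<open>An edge in column 1 gives the difference 0; an edge in column \<open>b\<close>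
      gives \<open>f\<close> or \<open>f'\<close>, depending on its orientation.\<close>
    from d(2) show ?thesis
      using f f' ideal_zero[OF I] by (auto simp: d_eq doubleton_eq_iff mult.commute)
  qed
  show ?thesis
    using assms(7) unfolding joined_by_path_def
  proof (induction rule: rtrancl_induct)
    case base
    then show ?case using xD corner ideal_zero[OF I] by simp
  next
    case (step y z)
    let ?p = "indet (fst y, 1) :: 'k vpoly"
    have zD: "z \<in> verts_of D"
      using step.hyps(2) vedges_subset_verts by blast
    note verts = xD corner[OF xD] step.IH zD corner[OF zD]
    \<comment> \<open>The products containing \<open>indet y\<close> cancel, which leaves a multiple
      of \<open>?p\<close>. Since \<open>?p\<close> is not in \<open>Q\<close>, primality removes
      it.\<close>
    have "indet (fst z, 1) * (indet x * ?p - indet y * indet (fst x, 1))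
        + indet (fst x, 1) * (indet y * indet (fst z, 1) - indet z * ?p) \<in> Q"
      using verts U step.hyps(2) edge
      by (intro ideal_add[OF I] ideal_mult[OF I] indet_closed) auto
    then have "?p * (indet x * indet (fst z, 1) - indet z * indet (fst x, 1)) \<in> Q"
      by (simp add: algebra_simps)
    moreover have "indet x * indet (fst z, 1) - indet z * indet (fst x, 1) \<in> carrier (poly_ring U)"
      using verts U by (intro poly_ring_closed indet_closed) auto
    ultimately have "indet x * indet (fst z, 1) - indet z * indet (fst x, 1) \<in> Q"
      using primeideal.I_prime[OF Q, of ?p] verts U nQ indet_closed[of "(fst y, 1)" U] by fastforce
    then show ?case using zD corner[OF zD] by simp
  qed
qed

section \<open>Products modulo ideals and primes\<close>

lemma prod_diff_in_ideal:
  fixes f g :: "nat \<Rightarrow> 'k::field vpoly"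
  assumes I: "ideal I (poly_ring U)"
    and "\<And>k. k < n \<Longrightarrow> f k \<in> carrier (poly_ring U)" "\<And>k. k < n \<Longrightarrow> g k \<in> carrier (poly_ring U)"
    and "\<And>k. k < n \<Longrightarrow> f k - g k \<in> I"
  shows "(\<Prod>k<n. f k) - (\<Prod>k<n. g k) \<in> I"
  using assms(2-)
proof (induction n)
  case 0
  then show ?case using ideal_zero[OF I] by simp
next
  case (Suc n)
  \<comment> \<open>Telescoping: adding and subtracting \<open>f n\<close> times the product of the
    \<open>g k\<close> changes one factor at a time.\<close>
  have "f n * ((\<Prod>k<n. f k) - (\<Prod>k<n. g k)) + (\<Prod>k<n. g k) * (f n - g n) \<in> I"
    using Suc.prems Suc.IH
    by (intro ideal_add[OF I] ideal_mult[OF I] prod_closed) auto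
  then show ?case by (simp add: algebra_simps)
qed

lemma primeideal_mult:
  fixes Q :: "'k::field vpoly set"
  assumes "primeideal Q (poly_ring U)" "p * q \<in> Q"
    "p \<in> carrier (poly_ring U)" "q \<in> carrier (poly_ring U)"
  shows "p \<in> Q \<or> q \<in> Q"
  using primeideal.I_prime[OF assms(1,3,4)] assms(2) by simp

text \<open>The complement of a prime is closed under multiplication; the empty product is covered
  because \<open>Q\<close> is proper.\<close>

lemma prod_not_in_primeideal:
  fixes f :: "nat \<Rightarrow> 'k::field vpoly"
  assumes Q: "primeideal Q (poly_ring U)"
    and "\<And>k. k < n \<Longrightarrow> f k \<in> carrier (poly_ring U)" "\<And>k. k < n \<Longrightarrow> f k \<notin> Q"
  shows "(\<Prod>k<n. f k) \<notin> Q"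
  using assms(2-)
proof (induction n)
  case 0
  have I: "ideal Q (poly_ring U)" using Q by (rule primeideal.axioms)
  have "Q = carrier (poly_ring U)" if "1 \<in> Q"
    using ideal_mult[OF I that] ideal_subset[OF I] by auto
  then show ?case using primeideal.I_notcarr[OF Q] by auto
next
  case (Suc n)
  then have "(\<Prod>k<n. f k) \<notin> Q" "f n \<notin> Q" "f n \<in> carrier (poly_ring U)"
    "(\<Prod>k<n. f k) \<in> carrier (poly_ring U)"
    by (auto intro: prod_closed)
  then show ?case using primeideal_mult[OF Q] by fastforce
qed

text \<open>Each vertical interval gives a congruence between its two cycle vertices, weighted by
  the column 1 entries \<open>c\<close> of their rows. In the product around the cycle both sides
  carry the same product of the \<open>c k\<close>, which is not in \<open>Q\<close> and
  cancels.\<close>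

lemma cycle_poly_in_primeideal:
  fixes Q :: "'k::field vpoly set"
  assumes Q: "primeideal Q (poly_ring U)"
    and D: "\<forall>d\<in>D. corner_interval d" "minor_poly ` D \<subseteq> Q"
    and U: "verts_of D \<subseteq> U" and nQ: "\<forall>x\<in>verts_of D. indet x \<notin> Q"
    and cyc: "graph_cycle D hs vs"
  shows "cycle_poly hs vs \<in> Q"
proof -
  have I: "ideal Q (poly_ring U)" using Q by (rule primeideal.axioms)
  let ?r = "length hs"
  let ?out = "cycle_out hs vs" and ?in = "cycle_in hs vs"
  define c :: "nat \<Rightarrow> 'k vpoly" where "c k = indet (fst (?out k), 1)" for k
  have verts: "?out k \<in> verts_of D" "?in k \<in> verts_of D" if "k < ?r" for k
    using graph_cycleD[OF cyc that] by auto
  note ratio = vertical_ratio[OF Q D U nQ]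
  have corner: "(fst (?out k), 1) \<in> verts_of D" if "k < ?r" for k
    using ratio[OF verts(1)[OF that] refl_joined] by simp
  have c: "c k \<in> carrier (poly_ring U)" "c k \<notin> Q" if "k < ?r" for k
    using corner[OF that] U nQ unfolding c_def by (auto intro: indet_closed)
  have mod_less: "Suc k mod ?r < ?r" if "k < ?r" for k
    using that by (intro mod_less_divisor) linarith
  \<comment> \<open>\<open>?in k\<close> lies in the row of the next outgoing vertex, so its column
    1 entry is \<open>c\<close> at the shifted index.\<close>
  have "indet (?out k) * c (Suc k mod ?r) - indet (?in k) * c k \<in> Q" if k: "k < ?r" for k
    using ratio[OF verts(1)[OF k] sym_joined[OF graph_cycle_joined(2)[OF cyc k]]]
      joined_hedges_fst[OF graph_cycle_joined(1)[OF cyc k]]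
    by (simp add: c_def)
  then have "(\<Prod>k<?r. indet (?out k) * c (Suc k mod ?r)) - (\<Prod>k<?r. indet (?in k) * c k) \<in> Q"
    using c mod_less verts U by (intro prod_diff_in_ideal[OF I] poly_ring_closed indet_closed) auto
  moreover have "(\<Prod>k<?r. c (Suc k mod ?r)) = (\<Prod>k<?r. c k)"
    by (rule prod.reindex_bij_betw[OF bij_Suc_mod])
  ultimately have "(\<Prod>k<?r. c k) * cycle_poly hs vs \<in> Q"
    by (simp add: prod.distrib cycle_poly_def algebra_simps)
  moreover have "(\<Prod>k<?r. c k) \<in> carrier (poly_ring U)"
    using c by (intro prod_closed) auto
  moreover have "cycle_poly hs vs \<in> carrier (poly_ring U)"
    unfolding cycle_poly_def using verts U
    by (intro poly_ring_closed prod_closed indet_closed) auto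
  moreover have "(\<Prod>k<?r. c k) \<notin> Q"
    using prod_not_in_primeideal[OF Q] c by blast
  ultimately show ?thesis using primeideal_mult[OF Q] by blast
qed

text \<open>For each minor, one diagonal product lies in \<open>Q\<close> iff the other does, which
  makes \<open>W\<close> admissible. The minors avoiding \<open>W\<close> have no vertex in
  \<open>Q\<close>, so \<open>cycle_poly_in_primeideal\<close> applies to them.\<close>

lemma primeideal_contains_admissible_ideal:
  fixes Q :: "'k::field vpoly set"
  assumes corner: "\<forall>d\<in>C. corner_interval d"
    and Q: "primeideal Q (poly_ring (verts_of C))" "minor_ideal C \<subseteq> Q"
  defines "W \<equiv> {x \<in> verts_of C. indet x \<in> Q}"
  shows "admissible C W" and "admissible_ideal C W \<subseteq> Q"
proof -
  have I: "ideal Q (poly_ring (verts_of C))" using Q(1) by (rule primeideal.axioms)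
  have minors: "minor_poly ` C \<subseteq> Q"
    using Q(2) minor_ideal_subset_iff[OF I] by blast
  show "admissible C W"
    unfolding admissible_def
  proof (intro conjI ballI)
    fix d assume "d \<in> C"
    obtain a1 a2 b1 b2 where d: "d = Minor a1 a2 b1 b2" by (cases d)
    have verts: "minor_verts d \<subseteq> verts_of C"
      using \<open>d \<in> C\<close> unfolding verts_of_def by blast
    then have cl: "indet x \<in> carrier (poly_ring (verts_of C))" if "x \<in> minor_verts d" for x
      using that by (auto intro: indet_closed)
    let ?p = "indet (a1, b1) * indet (a2, b2) :: 'k vpoly"
    let ?q = "indet (a1, b2) * indet (a2, b1) :: 'k vpoly"
    have pq: "?p - ?q \<in> Q"
      using minors \<open>d \<in> C\<close> d by force
    have "?q \<in> Q" if "?p \<in> Q"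
      using ideal_diff[OF I that pq] by simp
    moreover have "?p \<in> Q" if "?q \<in> Q"
      using ideal_add[OF I pq that] by simp
    moreover have "?p \<in> Q \<longleftrightarrow> (a1, b1) \<in> W \<or> (a2, b2) \<in> W"
      using primeideal_mult[OF Q(1), of "indet (a1, b1)" "indet (a2, b2)"] cl verts
        ideal_mult[OF I, of "indet (a1, b1)" "indet (a2, b2)"]
        ideal_mult[OF I, of "indet (a2, b2)" "indet (a1, b1)"]
      by (auto simp: W_def d mult.commute)
    moreover have "?q \<in> Q \<longleftrightarrow> (a1, b2) \<in> W \<or> (a2, b1) \<in> W"
      using primeideal_mult[OF Q(1), of "indet (a1, b2)" "indet (a2, b1)"] cl verts
        ideal_mult[OF I, of "indet (a1, b2)" "indet (a2, b1)"]
        ideal_mult[OF I, of "indet (a2, b1)" "indet (a1, b2)"]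
      by (auto simp: W_def d mult.commute)
    ultimately have "(a1, b1) \<in> W \<or> (a2, b2) \<in> W \<longleftrightarrow> (a1, b2) \<in> W \<or> (a2, b1) \<in> W"
      by blast
    \<comment> \<open>Any vertex of one diagonal forms an edge with any vertex of the other.\<close>
    then show "W \<inter> minor_verts d = {} \<or> (\<exists>e\<in>minor_edges d. e \<subseteq> W \<inter> minor_verts d)"
      by (auto simp: d minor_edges_def)
  qed (auto simp: W_def)
  show "admissible_ideal C W \<subseteq> Q"
  proof (rule admissible_ideal_subset[OF I])
    show "indet ` W \<subseteq> Q" by (auto simp: W_def)
    fix hs vs assume cyc: "graph_cycle (avoiding C W) hs vs"
    have "\<forall>x\<in>verts_of (avoiding C W). indet x \<notin> Q"
      using verts_of_avoiding[of C W] verts_of_mono[OF avoiding_subset[of C W]]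
      unfolding W_def by blast
    moreover have "\<forall>d\<in>avoiding C W. corner_interval d"
      using corner avoiding_subset[of C W] by (meson subsetD)
    moreover have "minor_poly ` avoiding C W \<subseteq> Q"
      using minors by (rule subset_trans[OF image_mono[OF avoiding_subset]])
    ultimately show "cycle_poly hs vs \<in> Q"
      by (intro cycle_poly_in_primeideal[OF Q(1) _ _ verts_of_mono[OF avoiding_subset] _ cyc])
  qed
qed

text \<open>The toric map for \<open>V\<close> kills exactly the monomials that meet
  \<open>V\<close>. If both are killed the binomial is in the ideal; if one is, a nonzero monomial
  remains; if none is, the map agrees with the one for the empty set.\<close>

lemma cycle_poly_in_admissible_ideal_iff:
  assumes "V \<subseteq> verts_of C" "D \<subseteq> C" "graph_cycle D hs vs"
  shows "(cycle_poly hs vs :: 'k::field vpoly) \<in> admissible_ideal C V \<longleftrightarrow>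
    cycle_out hs vs ` {..<length hs} \<inter> V \<noteq> {} \<and> cycle_in hs vs ` {..<length hs} \<inter> V \<noteq> {} \<or>
    cycle_poly hs vs \<in> (cycle_ideal C (avoiding C V) :: 'k vpoly set)"
proof -
  let ?D = "avoiding C V" and ?p = "cycle_poly hs vs :: 'k vpoly"
  let ?o = "squarefree_monomial (cycle_out hs vs) (length hs)"
  let ?i = "squarefree_monomial (cycle_in hs vs) (length hs)"
  have closed: "?p \<in> carrier (poly_ring (verts_of C))"
    using cycle_poly_closed[OF assms(3,2)] by (simp add: ambient_ring_def)
  have adm: "?p \<in> admissible_ideal C V \<longleftrightarrow> toric_map V ?D ?p = 0"
    using closed by (simp add: admissible_ideal_eq_toric_kernel[OF assms(1)] toric_kernel_def)
  have cyc: "?p \<in> cycle_ideal C ?D \<longleftrightarrow> toric_map {} ?D ?p = 0"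
    using closed by (simp add: cycle_ideal_eq_toric_kernel[OF avoiding_subset] toric_kernel_def)
  \<comment> \<open>This inclusion settles the case where exactly one monomial meets
    \<open>V\<close>: the binomial is then in neither ideal.\<close>
  have "cycle_ideal C ?D \<subseteq> (admissible_ideal C V :: 'k vpoly set)"
    unfolding admissible_ideal_eq_toric_kernel[OF assms(1)]
    by (intro cycle_ideal_subset ideal_toric_kernel cycle_poly_in_toric_kernel
        avoiding_subset verts_of_avoiding)
  then show ?thesis
    unfolding keys_squarefree_monomial[symmetric]
    using adm cyc
    by (cases "keys ?o \<inter> V = {}"; cases "keys ?i \<inter> V = {}")
      (auto simp: cycle_poly_eq toric_map_diff single_eq_0_iff simp del: One_nat_def)
qed

section \<open>The cycle criterion for minimality\<close>

theorem theorem3p17: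
  fixes m n :: nat and C :: "minor set" and V :: "vertex set"
  assumes "C \<subseteq> {d \<in> two_minors m n. corner_interval d}"
    and "admissible C V"
  shows "minimal_prime (ambient_ring C) (minor_ideal C) (admissible_ideal C V :: 'k::field vpoly set) \<longleftrightarrow>
    (\<forall>W. admissible C W \<and> W \<subset> V \<longrightarrow>
      (\<exists>hs vs. graph_cycle (avoiding C W) hs vs \<and>
        (cycle_poly hs vs :: 'k vpoly) \<in>
          cycle_ideal C (avoiding C W) - cycle_ideal C (avoiding C V) \<and>
        (\<forall>k < length hs. \<forall>l < length hs. cycle_out hs vs k \<notin> V \<or> cycle_in hs vs l \<notin> V)))"
proof -
  let ?R = "poly_ring (verts_of C) :: 'k vpoly ring"
  let ?P = "\<lambda>W. admissible_ideal C W :: 'k vpoly set"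
  have corner: "\<forall>d\<in>C. corner_interval d" using assms(1) by blast
  have sub: "W \<subseteq> verts_of C" if "admissible C W" for W
    using that by (simp add: admissible_def)
  have prime: "primeideal (?P W) ?R" "minor_ideal C \<subseteq> ?P W"
    and vars: "\<And>x. x \<in> verts_of C \<Longrightarrow> indet x \<in> ?P W \<longleftrightarrow> x \<in> W" if "admissible C W" for W
    using minor_in_toric_kernel[OF that]
    by (auto simp: admissible_ideal_eq_toric_kernel[OF sub[OF that]] primeideal_toric_kernel
        indet_in_toric_kernel minor_ideal_subset_iff[OF ideal_toric_kernel])
  let ?E = "\<lambda>W. \<exists>hs vs. graph_cycle (avoiding C W) hs vs \<and>
        (cycle_poly hs vs :: 'k vpoly) \<in>
          cycle_ideal C (avoiding C W) - cycle_ideal C (avoiding C V) \<and>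
        (\<forall>k < length hs. \<forall>l < length hs. cycle_out hs vs k \<notin> V \<or> cycle_in hs vs l \<notin> V)"
  have P_subset: "?P W \<subseteq> ?P V \<longleftrightarrow> \<not> ?E W"
    if W: "admissible C W" "W \<subset> V" for W
  proof -
    have I: "ideal (?P V) ?R" using prime(1)[OF assms(2)] by (rule primeideal.axioms)
    have cyc_W: "(cycle_poly hs vs :: 'k vpoly) \<in> ?P W" if "graph_cycle (avoiding C W) hs vs" for hs vs
      unfolding admissible_ideal_eq_toric_kernel[OF sub[OF W(1)]]
      using that by (intro cycle_poly_in_toric_kernel avoiding_subset verts_of_avoiding)
    have "indet ` W \<subseteq> ?P V"
      using vars[OF assms(2)] W(2) sub[OF assms(2)] by blast
    \<comment> \<open>The variables of \<open>W\<close> already lie in \<open>?P V\<close>, so the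
      cycle binomials decide the inclusion.\<close>
    then have "?P W \<subseteq> ?P V \<longleftrightarrow>
        (\<forall>hs vs. graph_cycle (avoiding C W) hs vs \<longrightarrow> (cycle_poly hs vs :: 'k vpoly) \<in> ?P V)"
      using admissible_ideal_subset[OF I, of W] cyc_W by blast
    moreover have "(cycle_poly hs vs :: 'k vpoly) \<notin> ?P V \<longleftrightarrow>
        (cycle_poly hs vs :: 'k vpoly) \<in>
          cycle_ideal C (avoiding C W) - cycle_ideal C (avoiding C V) \<and>
        (\<forall>k < length hs. \<forall>l < length hs. cycle_out hs vs k \<notin> V \<or> cycle_in hs vs l \<notin> V)"
      if "graph_cycle (avoiding C W) hs vs" for hs vs
    proof -
      have "(cycle_poly hs vs :: 'k vpoly) \<in> cycle_ideal C (avoiding C W)"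
        using that by (rule cycle_ideal(2)[OF avoiding_subset])
      \<comment> \<open>That no pair \<open>k\<close>, \<open>l\<close> has both vertices in
        \<open>V\<close> says exactly that one of the two monomials avoids \<open>V\<close>.\<close>
      then show ?thesis
        using cycle_poly_in_admissible_ideal_iff[OF sub[OF assms(2)] avoiding_subset that, where 'k='k]
        by auto
    qed
    ultimately show ?thesis by blast
  qed
  have "minimal_prime (ambient_ring C) (minor_ideal C) (?P V) \<longleftrightarrow>
      (\<forall>W. admissible C W \<and> W \<subset> V \<longrightarrow> \<not> ?P W \<subseteq> ?P V)"
  proof
    assume min: "minimal_prime (ambient_ring C) (minor_ideal C) (?P V)"
    show "\<forall>W. admissible C W \<and> W \<subset> V \<longrightarrow> \<not> ?P W \<subseteq> ?P V"
    proof (intro allI impI notI)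
      fix W assume W: "admissible C W \<and> W \<subset> V" and "?P W \<subseteq> ?P V"
      with min prime[of W] have "?P W = ?P V"
        unfolding minimal_prime_def ambient_ring_def by blast
      \<comment> \<open>Each ideal contains exactly its own vertices, so a vertex in
        \<open>V\<close> outside \<open>W\<close> separates the two.\<close>
      then show False
        using W vars[of W] vars[OF assms(2)] sub[OF assms(2)] by blast
    qed
  next
    assume not_sub: "\<forall>W. admissible C W \<and> W \<subset> V \<longrightarrow> \<not> ?P W \<subseteq> ?P V"
    have "Q = ?P V" if Q: "primeideal Q ?R" "minor_ideal C \<subseteq> Q" "Q \<subseteq> ?P V" for Q
    proof -
      \<comment> \<open>The vertices in \<open>Q\<close> form an admissible subset of
        \<open>V\<close> whose ideal lies in \<open>Q\<close>; if it were proper, this would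
        contradict \<open>not_sub\<close>.\<close>
      define W where "W = {x \<in> verts_of C. indet x \<in> Q}"
      have W: "admissible C W" "?P W \<subseteq> Q"
        using primeideal_contains_admissible_ideal[OF corner Q(1,2)] by (simp_all add: W_def)
      have "W \<subseteq> V"
        using Q(3) vars[OF assms(2)] by (auto simp: W_def)
      with not_sub W Q(3) have "W = V" by blast
      with W(2) Q(3) show ?thesis by blast
    qed
    then show "minimal_prime (ambient_ring C) (minor_ideal C) (?P V)"
      using prime[OF assms(2)] unfolding minimal_prime_def ambient_ring_def by blast
  qed
  also have "\<dots> \<longleftrightarrow> (\<forall>W. admissible C W \<and> W \<subset> V \<longrightarrow> ?E W)"
  proof (rule iff_allI)
    fix W
    show "(admissible C W \<and> W \<subset> V \<longrightarrow> \<not> ?P W \<subseteq> ?P V) \<longleftrightarrow> (admissible C W \<and> W \<subset> V \<longrightarrow> ?E W)"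
    proof (cases "admissible C W \<and> W \<subset> V")
      case True
      then have "?P W \<subseteq> ?P V \<longleftrightarrow> \<not> ?E W" by (intro P_subset) simp_all
      then show ?thesis by argo
    next
      case False
      then show ?thesis by argo
    qed
  qed
  finally show ?thesis .
qed

end
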